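(* Let $X$ be a real nonzero Banach space and $S,T:X\rightrightarrows X^*$ maximal monotone operators of Gossez type (D) with strong representative functions $h_S,h_T$ such that $\operatorname{pr}_{X^*}(\operatorname{dom}h_S)\cap\operatorname{pr}_{X^*}(\operatorname{dom}h_T)\neq\emptyset$ and $D(\overline S)\subseteq X$ (or $D(\overline T)\subseteq X$). Write $P:=\operatorname{pr}_{X^*}(\operatorname{dom}h_S)-\operatorname{pr}_{X^*}(\operatorname{dom}h_T)$. Then (a) ${}^{ic}(R(S)-R(T))=\operatorname{ri}(R(S)-R(T))={}^{ic}(\operatorname{co}R(S)-\operatorname{co}R(T))=\operatorname{ri}(\operatorname{co}R(S)-\operatorname{co}R(T))={}^{ic}P=\operatorname{ri}P$; (b) consequently the conditions $0\in{}^{ic}(R(S)-R(T))$, $0\in\operatorname{ri}(R(S)-R(T))$, $0\in{}^{ic}(\operatorname{co}R(S)-\operatorname{co}R(T))$, $0\in\operatorname{ri}(\operatorname{co}R(S)-\operatorname{co}R(T))$, $0\in{}^{ic}P$, $0\in\operatorname{ri}P$ are equivalent, and each implies that $S\|T$ is maximal monotone of Gossez type (D).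
   Context: $X$ identified with its image in $X^{**}$. $G,D,R$ graph, domain, range; $\operatorname{co}$ convex hull. Coupling $c(x,x^* )=\langle x^*,x\rangle$. Conjugate of $h$ on $X\times X^*$: $h^*(x^*,x^{**})=\sup_{(x,y^* )}\{\langle x^*,x\rangle+\langle x^{**},y^*\rangle-h(x,y^* )\}$. Representative function of monotone $S$: convex norm-lsc $h_S$ with $h_S\ge c$ and $G(S)\subseteq\{h_S=c\}$; strong if $h_S^*(x^*,x^{**})\ge\langle x^{**},x^*\rangle$ for all. Gossez's closure $\overline S:X^{**}\rightrightarrows X^*$ has graph $\{(x^{**},x^* ):\langle x^{**}-y,x^*-y^*\rangle\ge0\ \forall(y,y^* )\in G(S)\}$; maximal monotone $S$ is of Gossez type (D) if each point of $G(\overline S)$ is the $w^*\times\|\cdot\|_*$-limit of a bounded net in $G(S)$. $S\|T(x)=(S^{-1}+T^{-1})^{-1}(x)$. $\operatorname{icr}D=\{u:\forall x\in\operatorname{aff}(D-D)\ \exists\delta>0\ \forall\lambda\in[0,\delta]:u+\lambda x\in D\}$; ${}^{ic}D=\operatorname{icr}D$ if $\operatorname{aff}D$ closed, else $\emptyset$; $\operatorname{ri}D$ = interior relative to $\operatorname{aff}D$ if closed, else $\emptyset$. *)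

theory Defs
  imports "HOL-Analysis.Analysis" "HOL-Library.Extended_Real"
begin

(* X is a real Banach space (type 'a::banach); its dual X* is the type 'a \<Rightarrow>L real
  and its bidual X** is ('a \<Rightarrow>L real) \<Rightarrow>L real. Multivalued operators
  X \<rightrightarrows> X* are represented by their graphs. *)

type_synonym 'a dual = "'a \<Rightarrow>\<^sub>L real"
type_synonym 'a bidual = "('a \<Rightarrow>\<^sub>L real) \<Rightarrow>\<^sub>L real"
type_synonym 'a mop = "('a \<times> ('a \<Rightarrow>\<^sub>L real)) set"

definition canon :: "'a::banach \<Rightarrow> 'a bidual" where
  "canon x = Blinfun (\<lambda>f. blinfun_apply f x)"

definition monotone_op :: "'a::banach mop \<Rightarrow> bool" where
  "monotone_op G \<longleftrightarrow> (\<forall>(x,x')\<in>G. \<forall>(y,y')\<in>G. blinfun_apply (x' - y') (x - y) \<ge> 0)"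

definition maximal_monotone :: "'a::banach mop \<Rightarrow> bool" where
  "maximal_monotone G \<longleftrightarrow> monotone_op G \<and>
     (\<forall>H. monotone_op H \<and> G \<subseteq> H \<longrightarrow> H = G)"

definition range_op :: "'a::banach mop \<Rightarrow> 'a dual set" where
  "range_op G = snd ` G"

definition gossez_closure :: "'a::banach mop \<Rightarrow> ('a bidual \<times> 'a dual) set" where
  "gossez_closure G = {(u, v). \<forall>(y,y')\<in>G. blinfun_apply (u - canon y) (v - y') \<ge> 0}"

(* (u,v) is the (weak-star \<times> norm)-limit of a net with values in B \<subseteq> X \<times> X*
  (identified with a subset of X** \<times> X* via canon), i.e. (u,v) lies in the closure
  of B for the product of the weak-star topology on X** and the norm topology on X*. *)
definition wsn_limit_of :: "'a::banach mop \<Rightarrow> ('a bidual \<times> 'a dual) \<Rightarrow> bool" where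
  "wsn_limit_of B p \<longleftrightarrow> (\<forall>F. finite F \<longrightarrow> (\<forall>e>0. \<exists>(y,y')\<in>B.
      (\<forall>f\<in>F. \<bar>blinfun_apply (canon y) f - blinfun_apply (fst p) f\<bar> < e) \<and>
      norm (y' - snd p) < e))"

definition gossez_D :: "'a::banach mop \<Rightarrow> bool" where
  "gossez_D G \<longleftrightarrow> maximal_monotone G \<and>
     (\<forall>p\<in>gossez_closure G. \<exists>r. wsn_limit_of {(y,y')\<in>G. norm y \<le> r \<and> norm y' \<le> r} p)"

definition gossez_dom_in_X :: "'a::banach mop \<Rightarrow> bool" where
  "gossez_dom_in_X G \<longleftrightarrow> fst ` gossez_closure G \<subseteq> range canon"

definition coupling :: "'a::banach \<times> 'a dual \<Rightarrow> real" where
  "coupling p = blinfun_apply (snd p) (fst p)"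

definition convex_ereal :: "('b::real_vector \<Rightarrow> ereal) \<Rightarrow> bool" where
  "convex_ereal h \<longleftrightarrow> (\<forall>a b. \<forall>t::real. 0 < t \<and> t < 1 \<longrightarrow>
      h (t *\<^sub>R a + (1 - t) *\<^sub>R b) \<le> ereal t * h a + ereal (1 - t) * h b)"

definition lsc_ereal :: "('b::topological_space \<Rightarrow> ereal) \<Rightarrow> bool" where
  "lsc_ereal h \<longleftrightarrow> (\<forall>r::real. closed {p. h p \<le> ereal r})"

definition representative :: "'a::banach mop \<Rightarrow> ('a \<times> 'a dual \<Rightarrow> ereal) \<Rightarrow> bool" where
  "representative G h \<longleftrightarrow> convex_ereal h \<and> lsc_ereal h \<and>
     (\<forall>p. h p \<ge> ereal (coupling p)) \<and> (\<forall>p\<in>G. h p = ereal (coupling p))"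

definition conj_rep :: "('a::banach \<times> 'a dual \<Rightarrow> ereal) \<Rightarrow> 'a dual \<Rightarrow> 'a bidual \<Rightarrow> ereal" where
  "conj_rep h x' x'' = (SUP p. ereal (blinfun_apply x' (fst p) + blinfun_apply x'' (snd p)) - h p)"

definition strong_representative :: "'a::banach mop \<Rightarrow> ('a \<times> 'a dual \<Rightarrow> ereal) \<Rightarrow> bool" where
  "strong_representative G h \<longleftrightarrow> representative G h \<and>
     (\<forall>x' x''. conj_rep h x' x'' \<ge> ereal (blinfun_apply x'' x'))"

definition dom_ereal :: "('b \<Rightarrow> ereal) \<Rightarrow> 'b set" where
  "dom_ereal h = {p. h p < \<infinity>}"

definition set_diff :: "'b::ab_group_add set \<Rightarrow> 'b set \<Rightarrow> 'b set" where
  "set_diff A B = {a - b | a b. a \<in> A \<and> b \<in> B}"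

(* Graph of the parallel sum S\<parallel>T = (S\<inverse> + T\<inverse>)\<inverse>. *)
definition parallel_sum :: "'a::banach mop \<Rightarrow> 'a mop \<Rightarrow> 'a mop" where
  "parallel_sum S T = {(y + z, v) | y z v. (y, v) \<in> S \<and> (z, v) \<in> T}"

definition icr :: "'b::real_vector set \<Rightarrow> 'b set" where
  "icr D = {u. \<forall>x\<in>affine hull (set_diff D D). \<exists>\<delta>>0. \<forall>l. 0 \<le> l \<and> l \<le> \<delta> \<longrightarrow> u + l *\<^sub>R x \<in> D}"

definition ic :: "'b::real_normed_vector set \<Rightarrow> 'b set" where
  "ic D = (if closed (affine hull D) then icr D else {})"

definition ri :: "'b::real_normed_vector set \<Rightarrow> 'b set" where
  "ri D = (if closed (affine hull D) then rel_interior D else {})"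

end

theory Submission
  imports Defs
begin

text \<open>
  Replace a representative function by its epigraph \<open>E\<close>, a closed convex set on which
  \<open>coupling p \<le> r\<close>, and recover the operator as the set of contact points \<open>(p, coupling p) \<in> E\<close>.

  Strongness says exactly that the Fenchel dual of minimising \<open>r + k x + k* (- x')\<close> over \<open>E\<close> has value
  at most \<open>0\<close>. With \<open>k\<close> a squared norm, near-minimisers improve any almost-contact point, and
  iterating gives a Bronsted-Rockafellar property. With \<open>k\<close> a small multiple of a squared norm plus a
  penalty for finitely many functionals, near-minimisers approximate a given point of Gossez's closure
  by contact points of bounded norm; so the contact set of a strong epigraph is of type (D).

  Adding the epigraphs of \<open>S\<close> and \<open>T\<close> in the first variable gives, after closure, an epigraph which is
  strong as soon as \<open>0 \<in> ic P\<close>: there the Robinson-Ursescu theorem bounds the marginal function near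
  \<open>0\<close>, and Hahn-Banach splits the dual variable. If the Gossez closure of \<open>S\<close> or \<open>T\<close> has its domain
  in \<open>X\<close>, the split of a contact point lies in \<open>X\<close>, so the contact set is the parallel sum.

  For the equalities, translating \<open>w \<in> ic P\<close> to the origin produces a maximal monotone, hence nonempty,
  parallel sum, so \<open>w \<in> R(S) - R(T)\<close>; conversely \<open>P\<close> is contained in the closure of
  \<open>R(S) - R(T)\<close>, because the projected epigraphs lie in the closures of the ranges.
\<close>

section \<open>Convex separation\<close>

text \<open>The conjugate of a representative function lives on the dual times the bidual, and
  without reflexivity neither its supremum nor the infima of the minimisation problems need be
  attained. All duality statements are therefore kept with an arbitrary slack, and exact points are
  recovered only afterwards, from the completeness of X and its dual. The single duality tool is an
  affine minorant theorem for convex sets of pairs (perturbation, value). A multiplier for a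
  perturbation of the dual variable is a functional on the dual, hence an element of the bidual;
  this is the obstacle in the parallel sum, where the two pieces of a point x of X a priori lie only
  in the bidual.

  A contact set of a strong epigraph comes with its maximality, so sums and translates of epigraphs
  need no separate maximality argument. The set R(S) - R(T) need not be convex, so openness is
  proved for P and then handed down to every set between R(S) - R(T) and P.\<close>

definition sublinear :: "('v::real_vector \<Rightarrow> real) \<Rightarrow> bool" where
  "sublinear p \<longleftrightarrow> (\<forall>x y. p (x + y) \<le> p x + p y) \<and> (\<forall>t>0. \<forall>x. p (t *\<^sub>R x) \<le> t * p x)"

lemma sublinear_add: "sublinear p \<Longrightarrow> p (x + y) \<le> p x + p y"
  by (simp add: sublinear_def)

lemma sublinear_scale:
  assumes p: "sublinear p" and t: "t > 0"
  shows "p (t *\<^sub>R x) = t * p x"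
proof (rule antisym)
  show "p (t *\<^sub>R x) \<le> t * p x"
    using p t by (simp add: sublinear_def)
  have "p ((1 / t) *\<^sub>R t *\<^sub>R x) \<le> (1 / t) * p (t *\<^sub>R x)"
    using p t unfolding sublinear_def by (metis zero_less_divide_1_iff)
  then show "t * p x \<le> p (t *\<^sub>R x)"
    using t by (simp add: field_simps)
qed

lemma sublinear_zero: "sublinear p \<Longrightarrow> p 0 = 0"
  using sublinear_scale[of p 2 0] by simp

lemma sublinear_minus: "sublinear p \<Longrightarrow> - p (- x) \<le> p x"
  using sublinear_add[of p x "- x"] sublinear_zero[of p] by simp

text \<open>The bound is the pointwise infimum. It is finite because each member lies above or below
  a fixed \<open>p\<close>: in the first case \<open>p x\<close> bounds it at x, in the second
  \<open>- p (- x)\<close> does. It is subadditive because, of two members of a chain, the smaller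
  one can serve in both summands.\<close>

lemma sublinear_chain_lower_bound:
  assumes S: "\<And>q. q \<in> C \<Longrightarrow> sublinear q" and ne: "C \<noteq> {}"
    and ch: "\<And>q r. q \<in> C \<Longrightarrow> r \<in> C \<Longrightarrow> q \<le> r \<or> r \<le> q"
  shows "\<exists>u. sublinear u \<and> (\<forall>q\<in>C. u \<le> q)"
proof -
  obtain p where p: "p \<in> C" using ne by auto
  have bd: "bdd_below ((\<lambda>q. q x) ` C)" for x
  proof (rule bdd_belowI2)
    fix q assume q: "q \<in> C"
    have "min (- p (- x)) (p x) \<le> q x"
      using ch[OF p q]
    proof
      assume "p \<le> q" then show ?thesis by (auto simp: le_fun_def min_le_iff_disj)
    next
      assume "q \<le> p" then have "q (- x) \<le> p (- x)" by (simp add: le_fun_def)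
      with sublinear_minus[OF S[OF q], of x] show ?thesis by linarith
    qed
    then show "min (- p (- x)) (p x) \<le> q x" .
  qed
  define u where "u = (\<lambda>x. INF q\<in>C. q x)"
  have le: "u x \<le> q x" if "q \<in> C" for q x
    unfolding u_def by (rule cINF_lower[OF bd that])
  have "u (x + y) \<le> u x + u y" for x y
  proof -
    have 1: "u (x + y) \<le> q x + r y" if q: "q \<in> C" and r: "r \<in> C" for q r
      using ch[OF q r]
    proof
      assume "q \<le> r"
      then show ?thesis
        using le[OF q, of "x + y"] sublinear_add[OF S[OF q], of x y] by (simp add: le_fun_def) (smt (verit))
    next
      assume "r \<le> q"
      then show ?thesis
        using le[OF r, of "x + y"] sublinear_add[OF S[OF r], of x y] by (simp add: le_fun_def) (smt (verit))
    qed
    have "u (x + y) - q x \<le> u y" if q: "q \<in> C" for q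
      unfolding u_def[of] by (rule cINF_greatest[OF ne]) (use 1[OF q] in \<open>simp add: u_def algebra_simps\<close>)
    then have "u (x + y) - u y \<le> u x"
      by (subst (3) u_def, intro cINF_greatest[OF ne]) (smt (verit))
    then show ?thesis by simp
  qed
  moreover have "u (t *\<^sub>R x) \<le> t * u x" if t: "t > 0" for t x
  proof -
    have "u (t *\<^sub>R x) / t \<le> u x"
    proof (subst (2) u_def, intro cINF_greatest[OF ne])
      fix q assume q: "q \<in> C"
      show "u (t *\<^sub>R x) / t \<le> q x"
        using le[OF q, of "t *\<^sub>R x"] sublinear_scale[OF S[OF q] t, of x] t
        by (simp add: field_simps)
    qed
    then show ?thesis using t by (simp add: field_simps)
  qed
  ultimately have "sublinear u" by (simp add: sublinear_def)
  then show ?thesis using le by (auto simp: le_fun_def)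
qed

text \<open>A minimal sublinear function \<open>m\<close> agrees with \<open>x \<mapsto> INF t. m (x + t y) - t m y\<close>, which forces
  additivity.\<close>
lemma minimal_sublinear_imp_linear:
  assumes m: "sublinear m" and min: "\<And>q. sublinear q \<Longrightarrow> q \<le> m \<Longrightarrow> q = m"
  shows "linear m"
proof -
  have add: "m x + m y \<le> m (x + y)" for x y
  proof -
    define q where "q = (\<lambda>x. INF t\<in>{0..}. m (x + t *\<^sub>R y) - t * m y)"
    have ty: "m (t *\<^sub>R y) = t * m y" if "t \<ge> 0" for t
      using sublinear_scale[OF m, of t y] sublinear_zero[OF m] that by (cases "t = 0") auto
    have bd: "bdd_below ((\<lambda>t. m (x + t *\<^sub>R y) - t * m y) ` {0..})" for x
    proof (rule bdd_belowI2)
      fix t :: real assume t: "t \<in> {0..}"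
      show "- m (- x) \<le> m (x + t *\<^sub>R y) - t * m y"
        using sublinear_add[OF m, of "x + t *\<^sub>R y" "- x"] ty[of t] t by simp
    qed
    have le: "q x \<le> m (x + t *\<^sub>R y) - t * m y" if "t \<ge> 0" for x t
      unfolding q_def by (rule cINF_lower[OF bd]) (use that in auto)
    have "q (x + z) \<le> q x + q z" for x z
    proof -
      have 1: "q (x + z) \<le> (m (x + s *\<^sub>R y) - s * m y) + (m (z + t *\<^sub>R y) - t * m y)"
        if "s \<ge> 0" "t \<ge> 0" for s t
      proof -
        have "m (x + z + (s + t) *\<^sub>R y) \<le> m (x + s *\<^sub>R y) + m (z + t *\<^sub>R y)"
          using sublinear_add[OF m, of "x + s *\<^sub>R y" "z + t *\<^sub>R y"] by (simp add: algebra_simps)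
        then show ?thesis using le[of "s + t" "x + z"] that by (simp add: algebra_simps)
      qed
      have "q (x + z) - (m (x + s *\<^sub>R y) - s * m y) \<le> q z" if "s \<ge> 0" for s
        by (subst (2) q_def, intro cINF_greatest) (use 1[OF that] in \<open>auto simp: algebra_simps\<close>)
      then have "q (x + z) - q z \<le> q x"
        by (subst (3) q_def, intro cINF_greatest) (auto simp: algebra_simps)
      then show ?thesis by simp
    qed
    moreover have "q (c *\<^sub>R x) \<le> c * q x" if c: "c > 0" for c x
    proof -
      have "q (c *\<^sub>R x) / c \<le> q x"
      proof (subst (2) q_def, intro cINF_greatest)
        fix t :: real assume t: "t \<in> {0..}"
        have "m (c *\<^sub>R x + (c * t) *\<^sub>R y) = c * m (x + t *\<^sub>R y)"
          using sublinear_scale[OF m c, of "x + t *\<^sub>R y"] by (simp add: algebra_simps)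
        then show "q (c *\<^sub>R x) / c \<le> m (x + t *\<^sub>R y) - t * m y"
          using le[of "c * t" "c *\<^sub>R x"] t c by (simp add: field_simps)
      qed auto
      then show ?thesis using c by (simp add: field_simps)
    qed
    ultimately have "sublinear q" by (simp add: sublinear_def)
    moreover have "q \<le> m" using le[of 0] by (auto simp: le_fun_def)
    ultimately have "q = m" by (rule min)
    then show ?thesis using le[of 1 x] by simp
  qed
  have eq: "m (x + y) = m x + m y" for x y
    using add[of x y] sublinear_add[OF m, of x y] by simp
  have neg: "m (- x) = - m x" for x
    using eq[of x "- x"] sublinear_zero[OF m] by simp
  have "m (t *\<^sub>R x) = t * m x" for t x
  proof -
    consider "t > 0" | "t = 0" | "t < 0" by linarith
    then show ?thesis
    proof cases
      case 3
      then show ?thesis using sublinear_scale[OF m, of "- t" x] neg[of "t *\<^sub>R x"] by simp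
    qed (use sublinear_scale[OF m] sublinear_zero[OF m] in auto)
  qed
  with eq show ?thesis by (auto intro: linearI)
qed

text \<open>No functional on a subspace is extended: in the separation argument all constraints are
  encoded in \<open>p\<close>, so any linear minorant will do. Zorn's lemma is applied to the
  reversed pointwise order, whose maximal elements are the minimal sublinear functions.\<close>

theorem hahn_banach_sublinear:
  assumes p: "sublinear p"
  shows "\<exists>g. linear g \<and> g \<le> p"
proof -
  define A where "A = {q. sublinear q \<and> q \<le> p}"
  have "\<exists>m\<in>A. \<forall>a\<in>A. m \<ge> a \<longrightarrow> a = m"
  proof (rule predicate_Zorn)
    show "partial_order_on A (relation_of (\<ge>) A)"
      by (auto simp: partial_order_on_def preorder_on_def refl_on_def trans_def antisym_def
          relation_of_def)
    fix C assume C: "C \<in> Chains (relation_of (\<ge>) A)"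
    show "\<exists>u\<in>A. \<forall>a\<in>C. a \<ge> u"
    proof (cases "C = {}")
      case True then show ?thesis using p by (auto simp: A_def)
    next
      case False
      have CA: "C \<subseteq> A" using C by (auto simp: Chains_def relation_of_def)
      obtain u where u: "sublinear u" "\<forall>q\<in>C. u \<le> q"
        using sublinear_chain_lower_bound[of C] False C CA
        by (auto simp: Chains_def relation_of_def A_def)
      moreover have "u \<le> p" using u(2) False CA by (auto simp: A_def intro: order_trans)
      ultimately show ?thesis by (auto simp: A_def)
    qed
  qed
  then obtain m where m: "sublinear m" "m \<le> p" and min: "\<And>a. sublinear a \<Longrightarrow> a \<le> p \<Longrightarrow> a \<le> m \<Longrightarrow> a = m"
    by (auto simp: A_def)
  have "linear m"
    by (rule minimal_sublinear_imp_linear[OF m(1)]) (use m(2) min in \<open>meson order_trans\<close>)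
  with m show ?thesis by auto
qed

text \<open>Applying the bound to large multiples of a vector makes the additive constant
  disappear.\<close>

lemma dominated_linear_bounded:
  fixes g :: "'w::real_normed_vector \<Rightarrow> real"
  assumes g: "linear g" and b: "\<And>w. g w \<le> c + K * norm w"
  shows "bounded_linear g"
proof -
  have le: "g w \<le> K * norm w" for w
  proof (rule ccontr)
    assume "\<not> g w \<le> K * norm w"
    then have d: "g w - K * norm w > 0" by simp
    obtain n :: nat where n: "real n * (g w - K * norm w) > c"
      using ex_less_of_nat_mult[OF d] by blast
    have "real n * g w \<le> c + K * (real n * norm w)"
      using b[of "real n *\<^sub>R w"] linear_scale[OF g, of "real n" w] by simp
    with n show False by (simp add: algebra_simps)
  qed
  show ?thesis
  proof (rule bounded_linear_intro[where K = K])
    show "norm (g x) \<le> norm x * K" for x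
      using le[of x] le[of "- x"] linear_neg[OF g, of x] by (simp add: algebra_simps abs_le_iff)
  qed (use g in \<open>auto simp: linear_add linear_scale\<close>)
qed

text \<open>The function \<open>p\<close> is the infimal convolution of the cone generated by
  \<open>Q\<close> with K times the norm; the lower bound on \<open>Q\<close> keeps it finite. A
  linear minorant of \<open>p\<close> lies below \<open>Q\<close> (take the multiple 1 and
  \<open>l = w\<close>), and the norm term makes it continuous.\<close>

lemma convex_set_affine_minorant:
  fixes Q :: "('w::real_normed_vector \<times> real) set"
  assumes cv: "convex Q" and ne: "Q \<noteq> {}"
    and low: "\<And>w r. (w, r) \<in> Q \<Longrightarrow> r \<ge> - K * norm w"
    and K: "K \<ge> 0"
  shows "\<exists>g :: 'w \<Rightarrow>\<^sub>L real. \<forall>(w, r)\<in>Q. blinfun_apply g w \<le> r"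
proof -
  define A :: "(real \<times> 'w \<times> real) set" where "A = {0<..} \<times> Q"
  define F :: "'w \<Rightarrow> real \<times> 'w \<times> real \<Rightarrow> real" where "F = (\<lambda>w (t, l, r). t * r + K * norm (w - t *\<^sub>R l))"
  define p where "p = (\<lambda>w. INF a\<in>A. F w a)"
  have Ane: "A \<noteq> {}" using ne by (auto simp: A_def)
  have bd: "bdd_below (F w ` A)" for w
  proof (rule bdd_belowI2)
    fix a assume "a \<in> A"
    then obtain t l r where a: "a = (t, l, r)" "t > 0" "(l, r) \<in> Q"
      by (auto simp: A_def)
    have "t * r \<ge> - K * (t * norm l)"
      using mult_left_mono[OF low[OF a(3)], of t] a(2) by (simp add: algebra_simps)
    moreover have "K * (t * norm l) \<le> K * (norm w + norm (w - t *\<^sub>R l))"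
      using norm_triangle_ineq4[of w "w - t *\<^sub>R l"] K a(2) by (intro mult_left_mono) auto
    ultimately show "- K * norm w \<le> F w a"
      by (simp add: F_def a algebra_simps)
  qed
  have le: "p w \<le> F w a" if "a \<in> A" for w a
    unfolding p_def by (rule cINF_lower[OF bd that])
  have "p (x + y) \<le> p x + p y" for x y
  proof -
    have 1: "p (x + y) \<le> F x a + F y b" if a: "a \<in> A" and b: "b \<in> A" for a b
    proof -
      obtain t l r where a': "a = (t, l, r)" "t > 0" "(l, r) \<in> Q"
        using a by (auto simp: A_def)
      obtain s k q where b': "b = (s, k, q)" "s > 0" "(k, q) \<in> Q"
        using b by (auto simp: A_def)
      \<comment> \<open>The cone over \<open>Q\<close> is closed under addition: by convexity a sum
        of t times and s times points of \<open>Q\<close> is t + s times the point of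
        \<open>Q\<close> with these weights.\<close>
      define c where "c = (t / (t + s)) *\<^sub>R (l, r) + (s / (t + s)) *\<^sub>R (k, q)"
      have cQ: "c \<in> Q"
        unfolding c_def using a' b' by (intro convexD[OF cv]) (auto simp flip: add_divide_distrib)
      have nz: "t + s \<noteq> 0" using a' b' by simp
      have ts: "(t + s) *\<^sub>R c = (t *\<^sub>R l + s *\<^sub>R k, t * r + s * q)"
        using a' b' nz by (simp add: c_def scaleR_add_right distrib_left)
      have "(t + s, c) \<in> A" using cQ a' b' by (auto simp: A_def)
      from le[OF this, of "x + y"]
      have "p (x + y) \<le> (t + s) * snd c + K * norm (x + y - (t + s) *\<^sub>R fst c)"
        by (cases c) (simp add: F_def)
      also have "\<dots> = t * r + s * q + K * norm ((x - t *\<^sub>R l) + (y - s *\<^sub>R k))"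
        using arg_cong[OF ts, of fst] arg_cong[OF ts, of snd] by (simp add: algebra_simps)
      also have "\<dots> \<le> t * r + s * q + K * (norm (x - t *\<^sub>R l) + norm (y - s *\<^sub>R k))"
        using K by (intro add_left_mono mult_left_mono norm_triangle_ineq)
      also have "\<dots> = F x a + F y b" by (simp add: F_def a' b' algebra_simps)
      finally show ?thesis .
    qed
    have "p (x + y) - F x a \<le> p y" if "a \<in> A" for a
      by (subst (2) p_def, intro cINF_greatest[OF Ane]) (use 1[OF that] in \<open>simp add: algebra_simps\<close>)
    then have "p (x + y) - p y \<le> p x"
      by (subst (3) p_def, intro cINF_greatest[OF Ane]) (simp add: algebra_simps)
    then show ?thesis by simp
  qed
  moreover have "p (c *\<^sub>R x) \<le> c * p x" if c: "c > 0" for c x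
  proof -
    have "p (c *\<^sub>R x) / c \<le> p x"
    proof (subst (2) p_def, intro cINF_greatest[OF Ane])
      fix a assume a: "a \<in> A"
      then obtain t l r where a': "a = (t, l, r)" "t > 0" "(l, r) \<in> Q"
        by (auto simp: A_def)
      have "(c * t, l, r) \<in> A" using a' c by (auto simp: A_def)
      from le[OF this, of "c *\<^sub>R x"]
      have "p (c *\<^sub>R x) \<le> c * t * r + K * norm (c *\<^sub>R (x - t *\<^sub>R l))"
        by (simp add: F_def scaleR_diff_right)
      also have "\<dots> = c * F x a" using c by (simp add: F_def a' distrib_left)
      finally show "p (c *\<^sub>R x) / c \<le> F x a" using c by (simp add: field_simps)
    qed
    then show ?thesis using c by (simp add: field_simps)
  qed
  ultimately have "sublinear p" by (simp add: sublinear_def)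
  then obtain g where g: "linear g" "g \<le> p" using hahn_banach_sublinear by blast
  obtain l0 r0 where l0: "(l0, r0) \<in> Q" using ne by auto
  have "g w \<le> (r0 + K * norm l0) + K * norm w" for w
  proof -
    have "g w \<le> r0 + K * norm (w - l0)"
      using g(2) le[of "(1, l0, r0)" w] l0 by (auto simp: A_def F_def le_fun_def intro: order_trans)
    also have "\<dots> \<le> r0 + K * (norm w + norm l0)"
      using K by (intro add_left_mono mult_left_mono norm_triangle_ineq4)
    finally show ?thesis by (simp add: algebra_simps)
  qed
  then have bl: "bounded_linear g" using dominated_linear_bounded[OF g(1)] by blast
  have "g w \<le> r" if "(w, r) \<in> Q" for w r
    using g(2) le[of "(1, w, r)" w] that by (auto simp: A_def F_def le_fun_def intro: order_trans)
  then show ?thesis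
    by (intro exI[of _ "Blinfun g"]) (auto simp: bounded_linear_Blinfun_apply[OF bl])
qed

text \<open>An upper bound near 0 produces the lower bound needed for separation: 0 is a convex
  combination of \<open>w\<close> and the opposite point of norm \<open>d\<close>, where some value
  is at most \<open>M\<close>, so a very negative value at \<open>w\<close> would give a negative
  value at 0. The subspace \<open>L\<close> is there because the perturbations of a parallel sum may
  fill only a proper subspace.\<close>

lemma convex_set_affine_minorant_core:
  fixes Q :: "('w::real_normed_vector \<times> real) set"
  assumes cv: "convex Q" and L: "subspace L" and QL: "fst ` Q \<subseteq> L"
    and pos: "\<And>r. (0, r) \<in> Q \<Longrightarrow> r \<ge> 0"
    and d: "d > 0" and bd: "\<And>w. w \<in> L \<Longrightarrow> norm w \<le> d \<Longrightarrow> \<exists>r\<le>M. (w, r) \<in> Q"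
  shows "\<exists>g :: 'w \<Rightarrow>\<^sub>L real. \<forall>(w, r)\<in>Q. blinfun_apply g w \<le> r"
proof (rule convex_set_affine_minorant[OF cv, of "M / d"])
  obtain r0 where r0: "r0 \<le> M" "(0, r0) \<in> Q"
    using bd[of 0] subspace_0[OF L] d by auto
  then show "Q \<noteq> {}" by auto
  have M: "M \<ge> 0" using pos r0 by force
  then show "M / d \<ge> 0" using d by simp
  fix w r assume wr: "(w, r) \<in> Q"
  show "r \<ge> - (M / d) * norm w"
  proof (cases "w = 0")
    case True then show ?thesis using pos wr by simp
  next
    case False
    then have n: "norm w > 0" by simp
    have "w \<in> L" using wr QL by force
    then have "- (d / norm w) *\<^sub>R w \<in> L" by (intro subspace_scale[OF L])
    then obtain q where q: "q \<le> M" "(- (d / norm w) *\<^sub>R w, q) \<in> Q"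
      using bd[of "- (d / norm w) *\<^sub>R w"] n d by auto
    \<comment> \<open>The weight for which \<open>w\<close> and the opposite point of norm
      \<open>d\<close> average to 0.\<close>
    define t where "t = d / (d + norm w)"
    have s: "d + norm w > 0" using d n by linarith
    have t: "0 < t" "t < 1" using d n s unfolding t_def by (auto simp: divide_less_eq)
    have t1: "1 - t = norm w / (d + norm w)" using s unfolding t_def by (simp add: field_simps)
    have "t *\<^sub>R (w, r) + (1 - t) *\<^sub>R (- (d / norm w) *\<^sub>R w, q) \<in> Q"
      using t by (intro convexD[OF cv wr q(2)]) auto
    moreover have "t *\<^sub>R w + (1 - t) *\<^sub>R (- (d / norm w) *\<^sub>R w) = 0"
    proof -
      have "t *\<^sub>R w + (1 - t) *\<^sub>R (- (d / norm w) *\<^sub>R w) = (t - (1 - t) * (d / norm w)) *\<^sub>R w"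
        by (simp add: algebra_simps)
      also have "t - (1 - t) * (d / norm w) = 0"
        unfolding t1 using n d by (simp add: t_def field_simps)
      finally show ?thesis by simp
    qed
    ultimately have "(0, t * r + (1 - t) * q) \<in> Q"
      by (simp only: scaleR_Pair add_Pair real_scaleR_def)
    then have "t * r + (1 - t) * q \<ge> 0" by (rule pos)
    moreover have "(1 - t) * q \<le> (1 - t) * M" using q(1) t by (intro mult_left_mono) auto
    ultimately have "t * r + (1 - t) * M \<ge> 0" by linarith
    then have "(d * r + norm w * M) / (d + norm w) \<ge> 0"
      unfolding t1 by (simp add: t_def add_divide_distrib)
    then have "d * r + norm w * M \<ge> 0" using d n by (simp add: zero_le_divide_iff)
    then show ?thesis using d by (simp add: field_simps)
  qed
qed

section \<open>Strong epigraphs and their contact sets\<close>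

text \<open>The last clause says that the conjugate at \<open>(a, b)\<close> is at least
  \<open>b a\<close>, with a slack \<open>e\<close> in place of an extended real supremum. It also
  makes \<open>E\<close> nonempty.\<close>

definition strong_epi :: "(('a::banach \<times> 'a dual) \<times> real) set \<Rightarrow> bool" where
  "strong_epi E \<longleftrightarrow> convex E \<and> closed E \<and> (\<forall>(p, r)\<in>E. coupling p \<le> r) \<and>
     (\<forall>(a :: 'a dual) (b :: 'a bidual). \<forall>e>0. \<exists>x x' r. ((x, x'), r) \<in> E \<and>
        blinfun_apply a x + blinfun_apply b x' - r \<ge> blinfun_apply b a - e)"

definition contact :: "(('a::banach \<times> 'a dual) \<times> real) set \<Rightarrow> 'a mop" where
  "contact E = {p. (p, coupling p) \<in> E}"

lemma strong_epi_convex: "strong_epi E \<Longrightarrow> convex E"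
  and strong_epi_closed: "strong_epi E \<Longrightarrow> closed E"
  by (simp_all add: strong_epi_def)

lemma strong_epi_ge: "strong_epi E \<Longrightarrow> ((x, x'), r) \<in> E \<Longrightarrow> blinfun_apply x' x \<le> r"
  by (auto simp: strong_epi_def coupling_def)

lemma strong_epi_conj:
  assumes "strong_epi E" "e > 0"
  obtains x x' r where "((x, x'), r) \<in> E" "blinfun_apply a x + blinfun_apply b x' - r \<ge> blinfun_apply b a - e"
  using assms unfolding strong_epi_def by meson

lemma convex_combo_pair:
  assumes "convex E" "((x, x'), r) \<in> E" "((y, y'), s) \<in> E" "u \<ge> 0" "v \<ge> 0" "u + v = (1::real)"
  shows "((u *\<^sub>R x + v *\<^sub>R y, u *\<^sub>R x' + v *\<^sub>R y'), u * r + v * s) \<in> E"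
  using convexD[OF assms] by simp

text \<open>\<open>kc\<close> stands for the conjugate of \<open>k\<close>; \<open>tight\<close> is
  the half of this that matters. If the gap exceeded \<open>e\<close>, the perturbed values would
  form a convex set that is nonnegative over 0 and reaches below a constant over the unit ball, and
  its affine minorant, with components \<open>a\<close> and \<open>b\<close>, would contradict
  strongness at \<open>(- a, - b)\<close>.\<close>

lemma fenchel_gap_zero:
  fixes E :: "(('a::banach \<times> 'a dual) \<times> real) set" and k :: "'a \<Rightarrow> real" and kc :: "'a dual \<Rightarrow> real"
  assumes E: "strong_epi E" and k: "convex_on UNIV k" and kc: "convex_on UNIV kc"
    and tight: "\<And>a e. e > 0 \<Longrightarrow> \<exists>x. blinfun_apply a x - k x \<ge> kc a - e"
    and kb: "\<And>R. \<exists>M. \<forall>x. norm x \<le> R \<longrightarrow> k x \<le> M"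
    and kcb: "\<And>R. \<exists>M. \<forall>x. norm x \<le> R \<longrightarrow> kc x \<le> M"
    and e: "e > 0"
  shows "\<exists>x x' r. ((x, x'), r) \<in> E \<and> r + k x + kc (- x') \<le> e"
proof (rule ccontr)
  assume "\<not> ?thesis"
  then have no: "r + k x + kc (- x') > e" if "((x, x'), r) \<in> E" for x x' r
    using that by (meson not_less)
  define Q where "Q = {(w, \<rho>). \<exists>x x' r. ((x, x'), r) \<in> E \<and> 
     r + k (x + fst w) + kc (- (x' + snd w)) - e \<le> \<rho>}"
  have "\<exists>g :: ('a \<times> 'a dual) \<Rightarrow>\<^sub>L real. \<forall>(w, r)\<in>Q. g w \<le> r"
  proof -
    obtain x0 x0' r0 where E0: "((x0, x0'), r0) \<in> E"
      by (rule strong_epi_conj[OF E zero_less_one])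
    obtain M1 where M1: "\<And>x. norm x \<le> norm x0 + 1 \<Longrightarrow> k x \<le> M1" using kb by blast
    obtain M2 where M2: "\<And>x. norm x \<le> norm x0' + 1 \<Longrightarrow> kc x \<le> M2" using kcb by blast
    show ?thesis
    proof (rule convex_set_affine_minorant_core[where L = UNIV and d = 1 and M = "r0 + M1 + M2 - e"])
      show "convex Q"
      proof (rule convexI)
        fix p q and u v :: real
        assume p: "p \<in> Q" and q: "q \<in> Q" and uv: "u \<ge> 0" "v \<ge> 0" "u + v = 1"
        obtain w1 w1' \<rho> x x' r where p': "p = ((w1, w1'), \<rho>)" "((x, x'), r) \<in> E"
            "r + k (x + w1) + kc (- (x' + w1')) - e \<le> \<rho>"
          using p by (auto simp: Q_def)
        obtain w2 w2' \<sigma> y y' s where q': "q = ((w2, w2'), \<sigma>)" "((y, y'), s) \<in> E"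
            "s + k (y + w2) + kc (- (y' + w2')) - e \<le> \<sigma>"
          using q by (auto simp: Q_def)
        have "((u *\<^sub>R x + v *\<^sub>R y, u *\<^sub>R x' + v *\<^sub>R y'), u * r + v * s) \<in> E"
          by (rule convex_combo_pair[OF strong_epi_convex[OF E] p'(2) q'(2) uv])
        moreover have "k (u *\<^sub>R (x + w1) + v *\<^sub>R (y + w2)) \<le> u * k (x + w1) + v * k (y + w2)"
          using k uv by (auto simp: convex_on_def)
        moreover have "kc (u *\<^sub>R (- (x' + w1')) + v *\<^sub>R (- (y' + w2')))
            \<le> u * kc (- (x' + w1')) + v * kc (- (y' + w2'))"
          using kc uv by (auto simp: convex_on_def)
        moreover have "u * (r + k (x + w1) + kc (- (x' + w1')) - e) \<le> u * \<rho>"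
          "v * (s + k (y + w2) + kc (- (y' + w2')) - e) \<le> v * \<sigma>"
          using p'(3) q'(3) uv by (auto intro: mult_left_mono)
        moreover have "u * e + v * e = e" using uv(3) by (metis distrib_right mult_1)
        moreover have "u *\<^sub>R x + v *\<^sub>R y + (u *\<^sub>R w1 + v *\<^sub>R w2) = u *\<^sub>R (x + w1) + v *\<^sub>R (y + w2)"
          "- (u *\<^sub>R x' + v *\<^sub>R y' + (u *\<^sub>R w1' + v *\<^sub>R w2'))
            = u *\<^sub>R (- (x' + w1')) + v *\<^sub>R (- (y' + w2'))"
          by (simp_all add: algebra_simps)
        ultimately have "((u *\<^sub>R x + v *\<^sub>R y, u *\<^sub>R x' + v *\<^sub>R y'), u * r + v * s) \<in> E \<and>
           u * r + v * s + k (u *\<^sub>R x + v *\<^sub>R y + (u *\<^sub>R w1 + v *\<^sub>R w2)) +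
            kc (- (u *\<^sub>R x' + v *\<^sub>R y' + (u *\<^sub>R w1' + v *\<^sub>R w2'))) - e \<le> u * \<rho> + v * \<sigma>"
          by (simp add: algebra_simps)
        moreover have "u *\<^sub>R p + v *\<^sub>R q
            = ((u *\<^sub>R w1 + v *\<^sub>R w2, u *\<^sub>R w1' + v *\<^sub>R w2'), u * \<rho> + v * \<sigma>)"
          by (simp add: p' q')
        ultimately show "u *\<^sub>R p + v *\<^sub>R q \<in> Q"
          unfolding Q_def by (simp only: mem_Collect_eq prod.case fst_conv snd_conv) blast
      qed
      show "r \<ge> 0" if "(0, r) \<in> Q" for r
        using that no by (fastforce simp: Q_def)
      show "\<exists>r\<le>r0 + M1 + M2 - e. (w, r) \<in> Q" if "norm w \<le> 1" for w
      proof -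
        have "norm (fst w) \<le> 1" "norm (snd w) \<le> 1"
          using that norm_fst_le[of "fst w" "snd w"] norm_snd_le[of "snd w" "fst w"] by auto
        then have "norm (x0 + fst w) \<le> norm x0 + 1" "norm (- (x0' + snd w)) \<le> norm x0' + 1"
          using norm_triangle_ineq[of x0 "fst w"] norm_triangle_ineq[of x0' "snd w"]
          by (auto simp del: minus_add_distrib)
        then have "(w, r0 + M1 + M2 - e) \<in> Q"
          using E0 M1 M2 unfolding Q_def by (force intro!: add_mono)
        then show ?thesis by blast
      qed
    qed auto
  qed
  then obtain g :: "('a \<times> 'a dual) \<Rightarrow>\<^sub>L real" where g: "\<And>w r. (w, r) \<in> Q \<Longrightarrow> g w \<le> r" by blast
  define a :: "'a dual" where "a = Blinfun (\<lambda>x. g (x, 0))"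
  define b :: "'a bidual" where "b = Blinfun (\<lambda>x'. g (0, x'))"
  have a: "a x = g (x, 0)" for x
    unfolding a_def by (rule fun_cong[OF bounded_linear_Blinfun_apply])
      (intro bounded_linear_compose[OF blinfun.bounded_linear_right] bounded_linear_Pair bounded_linear_ident bounded_linear_zero)
  have b: "b x = g (0, x)" for x
    unfolding b_def by (rule fun_cong[OF bounded_linear_Blinfun_apply])
      (intro bounded_linear_compose[OF blinfun.bounded_linear_right] bounded_linear_Pair bounded_linear_ident bounded_linear_zero)
  have gab: "g (x, x') = a x + b x'" for x x'
    unfolding a b by (simp flip: blinfun.add_right)
  obtain x x' r where E1: "((x, x'), r) \<in> E" and
     x: "(- a) x + (- b) x' - r \<ge> (- b) (- a) - e / 3"
    by (rule strong_epi_conj[OF E, where e = "e / 3" and a = "- a" and b = "- b"]) (use e in simp)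
  obtain z where z: "a z - k z \<ge> kc a - e / 3" using tight[of "e / 3"] e by auto
  \<comment> \<open>This perturbation evaluates \<open>k\<close> at \<open>z\<close> and
    \<open>kc\<close> at \<open>a\<close> itself. The remaining term \<open>- b a\<close> is
    cancelled by strongness, and no conjugate of \<open>kc\<close> on the bidual enters.\<close>
  have "((z - x, - a - x'), r + k z + kc a - e) \<in> Q"
    using E1 by (force simp: Q_def)
  then have "g (z - x, - a - x') \<le> r + k z + kc a - e" by (rule g)
  then show False
    using x z e unfolding gab by (simp add: blinfun.bilinear_simps)
qed

section \<open>Squared norms, proximal points and approximation by contact points\<close>

lemma power2_convex_combo:
  fixes a b u v :: real
  assumes "u \<ge> 0" "v \<ge> 0" "u + v = 1"
  shows "(u * a + v * b)\<^sup>2 \<le> u * a\<^sup>2 + v * b\<^sup>2"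
proof -
  have v: "v = 1 - u" using assms by simp
  have "u * a\<^sup>2 + v * b\<^sup>2 - (u * a + v * b)\<^sup>2 = u * v * (a - b)\<^sup>2"
    unfolding v by (simp add: power2_eq_square algebra_simps)
  also have "\<dots> \<ge> 0" using assms by simp
  finally show ?thesis by simp
qed

lemma convex_on_power2:
  assumes f: "convex_on A f" and pos: "\<And>x. x \<in> A \<Longrightarrow> f x \<ge> 0"
  shows "convex_on A (\<lambda>x. (f x)\<^sup>2 :: real)"
proof -
  have "convex A" using f by (simp add: convex_on_def)
  moreover have "(f (u *\<^sub>R x + v *\<^sub>R y))\<^sup>2 \<le> u * (f x)\<^sup>2 + v * (f y)\<^sup>2"
    if "x \<in> A" "y \<in> A" "u \<ge> 0" "v \<ge> 0" "u + v = 1" for x y u v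
  proof -
    have "u *\<^sub>R x + v *\<^sub>R y \<in> A" using that \<open>convex A\<close> by (auto intro: convexD)
    then have "(f (u *\<^sub>R x + v *\<^sub>R y))\<^sup>2 \<le> (u * f x + v * f y)\<^sup>2"
      using f that pos by (intro power_mono) (auto simp: convex_on_def)
    also have "\<dots> \<le> u * (f x)\<^sup>2 + v * (f y)\<^sup>2" using that by (intro power2_convex_combo)
    finally show ?thesis .
  qed
  ultimately show ?thesis by (auto simp: convex_on_def)
qed

lemma convex_on_norm_diff: "convex_on UNIV (\<lambda>x. norm (x - c))"
proof -
  have "norm (u *\<^sub>R x + v *\<^sub>R y - c) \<le> u * norm (x - c) + v * norm (y - c)"
    if "u \<ge> 0" "v \<ge> 0" "u + v = 1" for x y and u v :: real
  proof -
    have "u *\<^sub>R x + v *\<^sub>R y - c = u *\<^sub>R (x - c) + v *\<^sub>R (y - c)"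
      using that(3) by (simp add: algebra_simps flip: scaleR_add_left)
    then show ?thesis using norm_triangle_ineq[of "u *\<^sub>R (x - c)" "v *\<^sub>R (y - c)"] that by simp
  qed
  then show ?thesis by (auto simp: convex_on_def)
qed

lemma convex_on_affine_functional:
  "linear f \<Longrightarrow> convex_on UNIV (\<lambda>x. f x + c :: real)"
  by (auto simp: convex_on_def linear_add linear_scale algebra_simps simp flip: distrib_right)

lemma blinfun_real_norm_attain:
  fixes b :: "'v::real_normed_vector \<Rightarrow>\<^sub>L real"
  assumes c: "0 \<le> c" "c < norm b"
  shows "\<exists>x. norm x = 1 \<and> b x > c"
proof (rule ccontr)
  assume *: "\<not> ?thesis"
  have le: "b x \<le> c * norm x" for x
  proof (cases "x = 0")
    case False
    then have "b ((1 / norm x) *\<^sub>R x) \<le> c" using * by (auto simp: not_less)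
    then show ?thesis using False by (simp add: blinfun.scaleR_right field_simps)
  qed simp
  have "norm (b x) \<le> c * norm x" for x
    using le[of x] le[of "- x"] by (simp add: blinfun.minus_right abs_le_iff)
  then have "norm b \<le> c" using c(1) by (intro norm_blinfun_bound)
  with c show False by simp
qed

lemma young_norm: "s * t \<le> l / 2 * s\<^sup>2 + t\<^sup>2 / (2 * l)" if "l > 0" for l s t :: real
proof -
  have "0 \<le> (l * s - t)\<^sup>2 / (2 * l)" using that by simp
  also have "\<dots> = l / 2 * s\<^sup>2 + t\<^sup>2 / (2 * l) - s * t"
    using that by (simp add: field_simps power2_eq_square)
  finally show ?thesis by simp
qed

lemma blinfun_young: "- (l / 2 * (norm x)\<^sup>2 + (norm b)\<^sup>2 / (2 * l)) \<le> b x"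
  "b x \<le> l / 2 * (norm x)\<^sup>2 + (norm b)\<^sup>2 / (2 * l)" if "l > 0" for b :: "'v::real_normed_vector \<Rightarrow>\<^sub>L real"
  using norm_blinfun[of b x] young_norm[OF that, of "norm x" "norm b"]
  by (auto simp: abs_le_iff algebra_simps)

lemma conj_norm_square_tight:
  fixes b :: "'v::real_normed_vector \<Rightarrow>\<^sub>L real"
  assumes l: "l > 0" and e: "e > 0"
  shows "\<exists>z. b z - l / 2 * (norm z)\<^sup>2 \<ge> (norm b)\<^sup>2 / (2 * l) - e"
proof (cases "b = 0")
  case True
  then show ?thesis using e by (intro exI[of _ 0]) auto
next
  case False
  \<comment> \<open>\<open>s\<close> maximises \<open>s * norm b - l / 2 * s\<^sup>2\<close>;
    \<open>d\<close> keeps the loss \<open>s * d\<close>, caused by an only almost norming vector,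
    below \<open>e\<close>.\<close>
  define s where "s = norm b / l"
  define d where "d = min (norm b) (e / s)"
  have s: "s > 0" using False l by (simp add: s_def)
  then have d: "d > 0" "d \<le> norm b" "d \<le> e / s" using False e by (auto simp: d_def)
  then obtain x where x: "norm x = 1" "b x > norm b - d"
    using blinfun_real_norm_attain[of "norm b - d" b] by auto
  have "s * b x \<ge> s * (norm b - d)" using x s by (intro mult_left_mono) auto
  moreover have "s * d \<le> e" using d s by (simp add: field_simps)
  moreover have "s * norm b - l / 2 * s\<^sup>2 = (norm b)\<^sup>2 / (2 * l)"
    using l by (simp add: s_def field_simps power2_eq_square)
  ultimately have "b (s *\<^sub>R x) - l / 2 * (norm (s *\<^sub>R x))\<^sup>2 \<ge> (norm b)\<^sup>2 / (2 * l) - e"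
    using x s by (simp add: blinfun.scaleR_right algebra_simps)
  then show ?thesis by blast
qed

text \<open>The gap theorem is used with \<open>l / 2 * (norm (x - x0))\<^sup>2 - x0' x\<close>,
  whose conjugate is explicit. The left side of the conclusion equals \<open>r - x' x\<close> plus
  \<open>(x' - x0') (x - x0)\<close> plus the two squares; the first part is nonnegative on
  \<open>E\<close>, the rest by Young's inequality, so each is at most \<open>e\<close>. The weight
  \<open>l\<close> trades closeness in X against closeness in the dual.\<close>

lemma strong_epi_prox:
  fixes E :: "(('a::banach \<times> 'a dual) \<times> real) set" and x0' :: "'a dual"
  assumes E: "strong_epi E" and l: "l > 0" and e: "e > 0"
  shows "\<exists>x x' r. ((x, x'), r) \<in> E \<and>
     r - x0' x - x' x0 + x0' x0 + l / 2 * (norm (x - x0))\<^sup>2 + (norm (x' - x0'))\<^sup>2 / (2 * l) \<le> e"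
proof -
  define k where "k = (\<lambda>x. l / 2 * (norm (x - x0))\<^sup>2 + (- x0' x + 0))"
  define kc where "kc = (\<lambda>a. 1 / (2 * l) * (norm (a - (- x0')))\<^sup>2 + (a x0 + x0' x0))"
  have "\<exists>x x' r. ((x, x'), r) \<in> E \<and> r + k x + kc (- x') \<le> e"
  proof (rule fenchel_gap_zero[OF E])
    show "convex_on UNIV k" unfolding k_def using l
      by (intro convex_on_add convex_on_cmul convex_on_power2 convex_on_norm_diff
          convex_on_affine_functional) (auto intro!: linearI simp: blinfun.bilinear_simps)
    show "convex_on UNIV kc" unfolding kc_def using l
      by (intro convex_on_add convex_on_cmul convex_on_power2 convex_on_norm_diff
          convex_on_affine_functional) (auto intro!: linearI simp: blinfun.bilinear_simps)
    show "\<exists>x. blinfun_apply a x - k x \<ge> kc a - d" if "d > 0" for a d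
    proof -
      obtain z where z: "(a + x0') z - l / 2 * (norm z)\<^sup>2 \<ge> (norm (a + x0'))\<^sup>2 / (2 * l) - d"
        using conj_norm_square_tight[OF l \<open>d > 0\<close>] by blast
      then show ?thesis
        by (intro exI[of _ "z + x0"]) (simp add: k_def kc_def blinfun.bilinear_simps)
    qed
    show "\<exists>M. \<forall>x. norm x \<le> R \<longrightarrow> k x \<le> M" for R
    proof (intro exI allI impI)
      fix x :: 'a assume x: "norm x \<le> R"
      have "norm (x - x0) \<le> R + norm x0" using norm_triangle_ineq4[of x x0] x by linarith
      then have "l / 2 * (norm (x - x0))\<^sup>2 \<le> l / 2 * (R + norm x0)\<^sup>2"
        using l by (intro mult_left_mono power_mono) auto
      moreover have "- x0' x \<le> norm x0' * R"
        using norm_blinfun[of x0' x] mult_left_mono[OF x norm_ge_zero[of x0']] by simp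
      ultimately show "k x \<le> l / 2 * (R + norm x0)\<^sup>2 + norm x0' * R" by (simp add: k_def)
    qed
    show "\<exists>M. \<forall>a. norm a \<le> R \<longrightarrow> kc a \<le> M" for R
    proof (intro exI allI impI)
      fix a :: "'a dual" assume a: "norm a \<le> R"
      have "norm (a + x0') \<le> R + norm x0'" using norm_triangle_ineq[of a x0'] a by linarith
      then have "1 / (2 * l) * (norm (a + x0'))\<^sup>2 \<le> 1 / (2 * l) * (R + norm x0')\<^sup>2"
        using l by (intro mult_left_mono power_mono) auto
      moreover have "a x0 \<le> R * norm x0"
        using norm_blinfun[of a x0] mult_right_mono[OF a norm_ge_zero[of x0]] by simp
      ultimately show "kc a \<le> 1 / (2 * l) * (R + norm x0')\<^sup>2 + (R * norm x0 + x0' x0)"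
        by (simp add: kc_def)
    qed
  qed (rule e)
  then obtain x x' r where "((x, x'), r) \<in> E" "r + k x + kc (- x') \<le> e" by blast
  then show ?thesis
    by (intro exI[of _ x] exI[of _ x'] exI[of _ r])
      (simp add: k_def kc_def blinfun.bilinear_simps norm_minus_commute)
qed

text \<open>The move is controlled by the excess \<open>K\<close> of the starting point: at the
  midpoint of the old and the new point \<open>coupling\<close> stays below the mean of
  \<open>r\<close> and \<open>r0\<close>, which bounds the cross terms \<open>x0' x + x' x0\<close>
  from above.\<close>

lemma strong_epi_step:
  fixes E :: "(('a::banach \<times> 'a dual) \<times> real) set" and x0' :: "'a dual"
  assumes E: "strong_epi E" and E0: "((x0, x0'), r0) \<in> E" and r0: "r0 \<le> x0' x0 + K"
    and l: "l > 0" and e: "e > 0"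
  shows "\<exists>x x' r. ((x, x'), r) \<in> E \<and> r \<le> x' x + e \<and>
     l * (norm (x - x0))\<^sup>2 + (norm (x' - x0'))\<^sup>2 / l \<le> 4 * (K + e)"
proof -
  obtain x x' r where E1: "((x, x'), r) \<in> E" and
    le: "r - x0' x - x' x0 + x0' x0 + l / 2 * (norm (x - x0))\<^sup>2 + (norm (x' - x0'))\<^sup>2 / (2 * l) \<le> e"
    using strong_epi_prox[OF E l e, of x0' x0] by blast
  have y: "(x' - x0') (x - x0) \<ge> - (l / 2 * (norm (x - x0))\<^sup>2 + (norm (x' - x0'))\<^sup>2 / (2 * l))"
    by (rule blinfun_young[OF l])
  have "((1/2) *\<^sub>R x' + (1/2) *\<^sub>R x0') ((1/2) *\<^sub>R x + (1/2) *\<^sub>R x0) \<le> 1/2 * r + 1/2 * r0"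
    by (rule strong_epi_ge[OF E], rule convex_combo_pair[OF strong_epi_convex[OF E] E1 E0]) auto
  then have mid: "x' x + x0' x + x' x0 + x0' x0 \<le> 2 * (r + r0)"
    by (simp add: blinfun.bilinear_simps field_simps)
  have "r \<le> x' x + e"
    using le y by (simp add: blinfun.bilinear_simps)
  moreover have "l * (norm (x - x0))\<^sup>2 + (norm (x' - x0'))\<^sup>2 / l
      = 2 * (l / 2 * (norm (x - x0))\<^sup>2 + (norm (x' - x0'))\<^sup>2 / (2 * l))"
    by simp
  moreover have "\<dots> \<le> 4 * (K + e)"
    using le y mid r0 by (simp add: blinfun.bilinear_simps)
  ultimately show ?thesis using E1 by metis
qed

lemma continuous_on_coupling: "continuous_on A coupling"
  unfolding coupling_def by (intro continuous_intros)

lemma strong_epi_coupling_le: "strong_epi E \<Longrightarrow> pr \<in> E \<Longrightarrow> coupling (fst pr) \<le> snd pr"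
  by (auto simp: strong_epi_def)

text \<open>Each step quarters the allowed excess, and its squared length is at most 5 e / 4^n, so
  its length is below 3 sqrt e / 2^n; the geometric series gives the constant 6. In the limit the
  excess vanishes because \<open>E\<close> is closed and \<open>coupling\<close> is
  continuous.\<close>

lemma strong_epi_bronsted_rockafellar:
  fixes E :: "(('a::banach \<times> 'a dual) \<times> real) set"
  assumes E: "strong_epi E" and E0: "(p0, r0) \<in> E" and r0: "r0 \<le> coupling p0 + e" and e: "e > 0"
  shows "\<exists>q\<in>contact E. norm (q - p0) \<le> 6 * sqrt e"
proof -
  \<comment> \<open>The clause for n = 0 pins the sequence obtained from dependent choice to the
    given starting point.\<close>
  define P where "P = (\<lambda>(n::nat) pr. pr \<in> E \<and> snd pr \<le> coupling (fst pr) + e / 4 ^ n \<and> (n = 0 \<longrightarrow> pr = (p0, r0)))"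
  have "\<exists>f. \<forall>n. P n (f n) \<and> norm (fst (f (Suc n)) - fst (f n)) \<le> 3 * sqrt e * (1/2) ^ n"
  proof (rule dependent_nat_choice)
    show "\<exists>x. P 0 x" using E0 r0 by (intro exI[of _ "(p0, r0)"]) (simp add: P_def)
    fix pr n assume "P n pr"
    then obtain x0 x0' r where pr: "pr = ((x0, x0'), r)" "((x0, x0'), r) \<in> E" "r \<le> x0' x0 + e / 4 ^ n"
      by (cases pr) (auto simp: P_def coupling_def)
    have e': "e / 4 ^ Suc n > 0" using e by simp
    obtain x x' s where s: "((x, x'), s) \<in> E" "s \<le> x' x + e / 4 ^ Suc n"
      "1 * (norm (x - x0))\<^sup>2 + (norm (x' - x0'))\<^sup>2 / 1 \<le> 4 * (e / 4 ^ n + e / 4 ^ Suc n)"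
      using strong_epi_step[OF E pr(2,3) zero_less_one e'] by blast
    have "(norm ((x, x') - (x0, x0')))\<^sup>2 \<le> 4 * (e / 4 ^ n + e / 4 ^ Suc n)"
      using s(3) by (simp add: norm_Pair)
    also have "\<dots> \<le> 9 * (e / 4 ^ n)"
      using e by (simp add: divide_right_mono)
    also have "\<dots> = (3 * sqrt e * (1/2) ^ n)\<^sup>2"
    proof -
      have "((1/2::real) ^ n)\<^sup>2 = 1 / 4 ^ n"
        by (simp add: power2_eq_square power_divide flip: power_mult_distrib)
      then show ?thesis using e by (simp add: power_mult_distrib)
    qed
    finally have "norm ((x, x') - (x0, x0')) \<le> 3 * sqrt e * (1/2) ^ n"
      by (rule power2_le_imp_le) (use e in simp)
    then show "\<exists>y. P (Suc n) y \<and> norm (fst y - fst pr) \<le> 3 * sqrt e * (1/2) ^ n"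
      using s(1,2) by (intro exI[of _ "((x, x'), s)"]) (simp add: P_def coupling_def pr(1))
  qed
  then obtain f where P: "\<And>n. P n (f n)"
    and nf: "\<And>n. norm (fst (f (Suc n)) - fst (f n)) \<le> 3 * sqrt e * (1/2) ^ n" by blast
  have gs: "(\<lambda>n. 3 * sqrt e * (1/2) ^ n) sums (3 * sqrt e * 2)"
    using geometric_sums[of "1/2::real"] by (intro sums_mult) simp
  have sn: "summable (\<lambda>n. norm (fst (f (Suc n)) - fst (f n)))"
    by (rule summable_comparison_test'[OF sums_summable[OF gs], of 0]) (use nf in simp)
  define s where "s = (\<Sum>n. fst (f (Suc n)) - fst (f n))"
  have "(\<lambda>n. \<Sum>i<n. fst (f (Suc i)) - fst (f i)) \<longlonglongrightarrow> s"
    unfolding s_def by (rule summable_LIMSEQ[OF summable_norm_cancel[OF sn]])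
  then have "(\<lambda>n. fst (f n) - p0) \<longlonglongrightarrow> s"
    using P[of 0] sum_lessThan_telescope[of "\<lambda>n. fst (f n)"] by (simp add: P_def)
  from tendsto_add[OF this tendsto_const[of p0]] have lim: "(\<lambda>n. fst (f n)) \<longlonglongrightarrow> s + p0" by simp
  have cl: "(\<lambda>n. coupling (fst (f n))) \<longlonglongrightarrow> coupling (s + p0)"
    by (rule continuous_on_tendsto_compose[OF continuous_on_coupling[of UNIV] lim]) auto
  have "(\<lambda>n. e * (1/4) ^ n) \<longlonglongrightarrow> e * 0"
    by (intro tendsto_mult tendsto_const LIMSEQ_realpow_zero) auto
  from tendsto_add[OF cl this]
  have cu: "(\<lambda>n. coupling (fst (f n)) + e / 4 ^ n) \<longlonglongrightarrow> coupling (s + p0)"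
    by (simp add: power_divide)
  have "(\<lambda>n. snd (f n)) \<longlonglongrightarrow> coupling (s + p0)"
  proof (rule tendsto_sandwich[OF _ _ cl cu])
    show "\<forall>\<^sub>F n in sequentially. coupling (fst (f n)) \<le> snd (f n)"
      using P strong_epi_coupling_le[OF E] by (intro always_eventually allI) (simp add: P_def)
    show "\<forall>\<^sub>F n in sequentially. snd (f n) \<le> coupling (fst (f n)) + e / 4 ^ n"
      using P by (auto simp: P_def)
  qed
  from tendsto_Pair[OF lim this] have "f \<longlonglongrightarrow> (s + p0, coupling (s + p0))" by simp
  then have "(s + p0, coupling (s + p0)) \<in> E"
    using P closed_sequentially[OF strong_epi_closed[OF E], of f] by (auto simp: P_def)
  moreover have "norm s \<le> 3 * sqrt e * 2"
    unfolding s_def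
    using summable_norm[OF sn] suminf_le[OF nf sn sums_summable[OF gs]] sums_unique[OF gs] by simp
  ultimately show ?thesis by (intro bexI[of _ "s + p0"]) (auto simp: contact_def)
qed

text \<open>The excess of the given point may be large, so no contact point need be near it. A small
  weight \<open>l\<close> lets the X component move far while the dual component hardly
  moves.\<close>

lemma strong_epi_range_dense:
  fixes E :: "(('a::banach \<times> 'a dual) \<times> real) set"
  assumes E: "strong_epi E" and E0: "((x0, x0'), r0) \<in> E"
  shows "x0' \<in> closure (snd ` contact E)"
proof (clarsimp simp: closure_approachable)
  fix d :: real assume d: "d > 0"
  define K where "K = \<bar>r0 - x0' x0\<bar>"
  have r0K: "r0 \<le> x0' x0 + K" by (simp add: K_def)
  \<comment> \<open>A quarter of \<open>d\<close> is reserved for the proximal step, through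
    \<open>l * (4 * (K + e)) = (d / 4)\<^sup>2\<close>, and a quarter for the passage to a contact
    point, through \<open>6 * sqrt e = d / 4\<close>.\<close>
  define e where "e = (d / 24)\<^sup>2"
  have e: "e > 0" and se: "6 * sqrt e = d / 4" using d by (auto simp: e_def)
  define l where "l = d\<^sup>2 / (64 * (K + e))"
  have Ke: "K + e > 0" using e by (simp add: K_def add_nonneg_pos)
  have l: "l > 0" using Ke d by (simp add: l_def)
  obtain x x' r where x: "((x, x'), r) \<in> E" "r \<le> x' x + e"
     "l * (norm (x - x0))\<^sup>2 + (norm (x' - x0'))\<^sup>2 / l \<le> 4 * (K + e)"
    using strong_epi_step[OF E E0 r0K l e] by blast
  have "(norm (x' - x0'))\<^sup>2 / l \<le> 4 * (K + e)"
    using x(3) l by (smt (verit) mult_nonneg_nonneg zero_le_power2)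
  then have "(norm (x' - x0'))\<^sup>2 \<le> l * (4 * (K + e))" using l by (simp add: field_simps)
  also have "\<dots> = (d / 4)\<^sup>2"
  proof -
    have "l * (64 * (K + e)) = d\<^sup>2" unfolding l_def using Ke by simp
    then have "l * (4 * (K + e)) = d\<^sup>2 / 16" by (simp add: algebra_simps)
    then show ?thesis by (simp add: power_divide)
  qed
  finally have 1: "norm (x' - x0') \<le> d / 4" using d by (simp add: power2_le_iff_abs_le)
  obtain q where q: "q \<in> contact E" "norm (q - (x, x')) \<le> d / 4"
    using strong_epi_bronsted_rockafellar[OF E x(1) _ e] x(2) se by (auto simp: coupling_def)
  have "norm (snd q - x') \<le> d / 4"
    using norm_snd_le[of "snd q - x'" "fst q - x"] q(2) by (cases q) auto
  then have "dist (snd q) x0' < d"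
    using 1 d norm_triangle_ineq[of "snd q - x'" "x' - x0'"] by (simp add: dist_norm)
  then show "\<exists>y\<in>contact E. dist (snd y) x0' < d" using q(1) by blast
qed

text \<open>Least squares takes the place of weak-star separation. At a near-minimiser
  \<open>x\<close> of the squared error \<open>s\<close> over the ball of radius
  \<open>norm u\<close>, first-order optimality makes the functional \<open>g\<close>, the members
  of \<open>F\<close> weighted by their errors at \<open>x\<close>, nearly maximal at
  \<open>x\<close> on that ball. Its supremum there is \<open>norm u * norm g\<close>, which is at
  least \<open>u g\<close>, so \<open>s x = u g - g x\<close> is small.\<close>

lemma goldstine:
  fixes u :: "('v::real_normed_vector \<Rightarrow>\<^sub>L real) \<Rightarrow>\<^sub>L real" and F :: "('v \<Rightarrow>\<^sub>L real) set"
  assumes F: "finite F" and e: "e > 0"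
  shows "\<exists>x. norm x \<le> norm u \<and> (\<forall>f\<in>F. \<bar>blinfun_apply f x - u f\<bar> < e)"
proof -
  define s where "s = (\<lambda>x. \<Sum>f\<in>F. (blinfun_apply f x - u f)\<^sup>2)"
  define B where "B = {x::'v. norm x \<le> norm u}"
  have s0: "s x \<ge> 0" for x by (simp add: s_def sum_nonneg)
  have Bne: "B \<noteq> {}" by (auto simp: B_def intro: exI[of _ 0])
  define N where "N = (\<Sum>f\<in>F. (norm f * (2 * norm u))\<^sup>2)"
  have N: "N \<ge> 0" by (simp add: N_def sum_nonneg)
  \<comment> \<open>Moving the fraction \<open>t\<close> towards another point of the ball has a
    second-order cost of at most t^2 N, and \<open>x\<close> is minimal up to t^2. Divided by t,
    both leave the error t (N + 1), which this choice puts below e^2.\<close>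
  define t where "t = min 1 (e\<^sup>2 / (N + 2))"
  have t: "0 < t" "t \<le> 1" using e N by (auto simp: t_def)
  have "t * (N + 1) < e\<^sup>2"
  proof -
    have "t * (N + 1) < t * (N + 2)" using t by simp
    also have "t \<le> e\<^sup>2 / (N + 2)" by (simp add: t_def)
    then have "t * (N + 2) \<le> e\<^sup>2" using N by (simp add: pos_le_divide_eq)
    finally show ?thesis .
  qed
  have "\<exists>x\<in>B. s x < (INF x\<in>B. s x) + t\<^sup>2"
  proof (rule ccontr)
    assume "\<not> ?thesis"
    then have "(INF x\<in>B. s x) + t\<^sup>2 \<le> (INF x\<in>B. s x)"
      by (intro cINF_greatest[OF Bne]) (auto simp: not_less)
    with t show False by simp
  qed
  then obtain x where x: "x \<in> B" "s x < (INF x\<in>B. s x) + t\<^sup>2" by blast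
  have min: "s x \<le> s y + t\<^sup>2" if "y \<in> B" for y
  proof -
    have "(INF x\<in>B. s x) \<le> s y"
      by (rule cINF_lower[OF _ that]) (rule bdd_belowI2[where m = 0], rule s0)
    with x show ?thesis by simp
  qed
  define g where "g = (\<Sum>f\<in>F. (u f - blinfun_apply f x) *\<^sub>R f)"
  have g: "g y = (\<Sum>f\<in>F. (u f - blinfun_apply f x) * blinfun_apply f y)" for y
    by (simp add: g_def blinfun.sum_left blinfun.scaleR_left)
  have ug: "u g = (\<Sum>f\<in>F. (u f - blinfun_apply f x) * u f)"
    by (simp add: g_def blinfun.sum_right blinfun.scaleR_right)
  have gle: "2 * (g y - g x) \<le> t * (N + 1)" if y: "y \<in> B" for y
  proof -
    define z where "z = x + t *\<^sub>R (y - x)"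
    have "z = (1 - t) *\<^sub>R x + t *\<^sub>R y" by (simp add: z_def algebra_simps)
    also have "\<dots> \<in> cball 0 (norm u)"
      using x y t by (intro convexD[OF convex_cball]) (auto simp: B_def)
    finally have "z \<in> B" by (simp add: B_def)
    have "s z = (\<Sum>f\<in>F. (blinfun_apply f x - u f)\<^sup>2 - 2 * t * ((u f - blinfun_apply f x) * blinfun_apply f y - (u f - blinfun_apply f x) * blinfun_apply f x)
         + t\<^sup>2 * (blinfun_apply f (y - x))\<^sup>2)"
      unfolding s_def z_def
      by (intro sum.cong refl) (simp add: blinfun.bilinear_simps power2_eq_square algebra_simps)
    also have "\<dots> = s x - 2 * t * (g y - g x) + t\<^sup>2 * (\<Sum>f\<in>F. (blinfun_apply f (y - x))\<^sup>2)"
      by (simp add: s_def g sum.distrib sum_subtractf sum_distrib_left right_diff_distrib)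
    finally have sz: "s z = \<dots>" .
    have "(\<Sum>f\<in>F. (blinfun_apply f (y - x))\<^sup>2) \<le> N"
      unfolding N_def
    proof (rule sum_mono)
      fix f assume "f \<in> F"
      have "norm (y - x) \<le> 2 * norm u"
        using x y norm_triangle_ineq4[of y x] by (simp add: B_def)
      then have "\<bar>blinfun_apply f (y - x)\<bar> \<le> norm f * (2 * norm u)"
        using norm_blinfun[of f "y - x"] by (simp add: mult_left_mono order_trans)
      then show "(blinfun_apply f (y - x))\<^sup>2 \<le> (norm f * (2 * norm u))\<^sup>2" by (metis abs_ge_zero power2_abs power_mono)
    qed
    then have "t\<^sup>2 * (\<Sum>f\<in>F. (blinfun_apply f (y - x))\<^sup>2) \<le> t\<^sup>2 * N" by (intro mult_left_mono) auto
    then have "2 * t * (g y - g x) \<le> t\<^sup>2 * N + t\<^sup>2"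
      using min[OF \<open>z \<in> B\<close>] sz by linarith
    then have "t * (2 * (g y - g x)) \<le> t * (t * (N + 1))"
      by (simp add: power2_eq_square algebra_simps)
    then show ?thesis using t by simp
  qed
  have "u g - g x \<le> t * (N + 1) / 2"
  proof (rule ccontr)
    assume "\<not> ?thesis"
    then have big: "u g > g x + t * (N + 1) / 2" by simp
    have gx: "g y \<le> g x + t * (N + 1) / 2" if "y \<in> B" for y
      using gle[OF that] by (simp add: field_simps)
    then have "g x + t * (N + 1) / 2 \<ge> 0" using gx[of 0] by (simp add: B_def)
    then have un: "norm u > 0" "norm g > 0" using big by (auto simp: blinfun.zero_left blinfun.zero_right)
    have "(g x + t * (N + 1) / 2) / norm u < norm g"
      using big norm_blinfun[of u g] un by (simp add: field_simps)
    then obtain y where y: "norm y = 1" "g y > (g x + t * (N + 1) / 2) / norm u"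
      using blinfun_real_norm_attain[of "(g x + t * (N + 1) / 2) / norm u" g] \<open>g x + t * (N + 1) / 2 \<ge> 0\<close> un
      by auto
    have "g (norm u *\<^sub>R y) > g x + t * (N + 1) / 2"
      using y un by (simp add: blinfun.scaleR_right field_simps)
    moreover have "norm u *\<^sub>R y \<in> B" using y by (simp add: B_def)
    ultimately show False using gx by fastforce
  qed
  moreover have "s x = u g - g x"
    unfolding s_def ug g by (simp add: sum_subtractf[symmetric] power2_eq_square algebra_simps)
  ultimately have "s x \<le> t * (N + 1) / 2" by simp
  also have "\<dots> \<le> t * (N + 1)" using t N by simp
  also note \<open>t * (N + 1) < e\<^sup>2\<close>
  finally have "s x < e\<^sup>2" .
  have "\<bar>blinfun_apply f x - u f\<bar> < e" if f: "f \<in> F" for f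
  proof -
    have "(blinfun_apply f x - u f)\<^sup>2 \<le> s x"
      unfolding s_def by (rule member_le_sum[OF f _ F]) auto
    then have "\<bar>blinfun_apply f x - u f\<bar>\<^sup>2 < e\<^sup>2" using \<open>s x < e\<^sup>2\<close> by simp
    then show ?thesis using e by (simp add: power2_less_imp_less)
  qed
  then show ?thesis using x(1) by (auto simp: B_def)
qed

section \<open>Type (D)\<close>

lemma canon_apply [simp]: "blinfun_apply (canon x) f = blinfun_apply f x"
  unfolding canon_def by (simp add: bounded_linear_Blinfun_apply blinfun.bounded_linear_left)

text \<open>The penalty \<open>M\<close> on finitely many functionals steers the minimiser of a regularised problem
  towards \<open>u\<close> in the weak-star topology; by Goldstine's theorem this costs nothing compared with the
  plain squared norm.\<close>
lemma conjugate_penalised_square_lower: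
  fixes u :: "('v::real_normed_vector \<Rightarrow>\<^sub>L real) \<Rightarrow>\<^sub>L real" and F :: "('v \<Rightarrow>\<^sub>L real) set"
    and a :: "'v \<Rightarrow>\<^sub>L real"
  assumes F: "finite F" and M: "M \<ge> 0" and l: "l > 0"
  defines "m \<equiv> \<lambda>x. (norm x)\<^sup>2 / 2 + M * (\<Sum>f\<in>F. (blinfun_apply f x - u f)\<^sup>2)"
  defines "C \<equiv> (norm u + 4)\<^sup>2 / 2 + M * (\<Sum>f\<in>F. (1 + 4 * norm f)\<^sup>2)"
  shows "\<exists>x. u a - l * ((norm u)\<^sup>2 / 2 + 1) \<le> a x - l * m x"
    and "e > 0 \<Longrightarrow> \<exists>x. u a + 2 * norm a - l * C - e \<le> a x - l * m x"
proof -
  \<comment> \<open>The error \<open>d\<close> at \<open>a\<close> costs at most l / 2. On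
    \<open>F\<close> the squared errors are at most \<open>d\<close> since \<open>d \<le> 1\<close>,
    so the penalty is at most \<open>M * card F * d\<close>, hence at most 1 / 2.\<close>
  define d where "d = min (l / 2) (min 1 (1 / (2 * (M * card F + 1))))"
  have den: "2 * (M * card F + 1) > 0" using M by (simp add: add_nonneg_pos)
  have d: "d > 0" "d \<le> l / 2" "d \<le> 1" "d \<le> 1 / (2 * (M * card F + 1))"
    using l den by (auto simp: d_def)
  have Md: "M * card F * d \<le> 1 / 2"
  proof -
    have "d * (2 * (M * card F + 1)) \<le> 1" using d(4) den by (simp only: pos_le_divide_eq)
    then show ?thesis using d(1) by (simp add: algebra_simps)
  qed
  obtain x where x: "norm x \<le> norm u" "\<And>f. f \<in> insert a F \<Longrightarrow> \<bar>f x - u f\<bar> < d"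
    using goldstine[of "insert a F" d u] F d by auto
  have "(\<Sum>f\<in>F. (blinfun_apply f x - u f)\<^sup>2) \<le> (\<Sum>f\<in>F. d)"
  proof (rule sum_mono)
    fix f assume "f \<in> F"
    then have "\<bar>f x - u f\<bar> \<le> d" using x(2) by force
    then have "\<bar>f x - u f\<bar> * \<bar>f x - u f\<bar> \<le> d * 1" using d by (intro mult_mono) auto
    then show "(f x - u f)\<^sup>2 \<le> d" by (simp add: power2_eq_square)
  qed
  then have "M * (\<Sum>f\<in>F. (blinfun_apply f x - u f)\<^sup>2) \<le> 1 / 2"
    using mult_left_mono[OF _ M] Md by (fastforce intro: order_trans simp: mult.assoc)
  moreover have "(norm x)\<^sup>2 \<le> (norm u)\<^sup>2" using x(1) by (intro power_mono) auto
  ultimately have "m x \<le> (norm u)\<^sup>2 / 2 + 1 / 2"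
    unfolding m_def by (intro add_mono divide_right_mono) simp_all
  then have "l * m x \<le> l * ((norm u)\<^sup>2 / 2 + 1 / 2)" using l by (intro mult_left_mono) auto
  moreover have "u a \<le> a x + l / 2" using x(2)[of a] d(2) by auto
  ultimately have "u a - l * ((norm u)\<^sup>2 / 2 + 1) \<le> a x - l * m x" by (simp add: algebra_simps)
  then show "\<exists>x. u a - l * ((norm u)\<^sup>2 / 2 + 1) \<le> a x - l * m x" by blast
  assume e: "e > 0"
  define c where "c = min e 1"
  have c: "c > 0" "c \<le> e" "c \<le> 1" using e by (auto simp: c_def)
  obtain y where y: "norm y \<le> norm u" "\<And>f. f \<in> insert a F \<Longrightarrow> \<bar>f y - u f\<bar> < c"
    using goldstine[of "insert a F" c u] F c by auto
  have "\<exists>z. norm z \<le> 1 \<and> a z \<ge> norm a / 2"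
  proof (cases "a = 0")
    case False
    then obtain z where "norm z = 1" "a z > norm a / 2"
      using blinfun_real_norm_attain[of "norm a / 2" a] by auto
    then show ?thesis by (intro exI[of _ z]) auto
  qed (auto intro: exI[of _ 0])
  then obtain z where z: "norm z \<le> 1" "a z \<ge> norm a / 2" by blast
  \<comment> \<open>The shift by \<open>4 *\<^sub>R z\<close> raises the value of \<open>a\<close>
    by at least \<open>2 * norm a\<close>, while the penalised square stays below \<open>C\<close>,
    which does not depend on \<open>a\<close>.\<close>
  define x1 where "x1 = y + 4 *\<^sub>R z"
  have "norm x1 \<le> norm u + 4"
    using y(1) z(1) norm_triangle_ineq[of y "4 *\<^sub>R z"] by (simp add: x1_def)
  then have "(norm x1)\<^sup>2 \<le> (norm u + 4)\<^sup>2" by (intro power_mono) auto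
  moreover have "(\<Sum>f\<in>F. (blinfun_apply f x1 - u f)\<^sup>2) \<le> (\<Sum>f\<in>F. (1 + 4 * norm f)\<^sup>2)"
  proof (rule sum_mono)
    fix f assume "f \<in> F"
    then have "\<bar>f y - u f\<bar> \<le> 1" using y(2)[of f] c by force
    moreover have "\<bar>f z\<bar> \<le> norm f"
      using norm_blinfun[of f z] mult_left_mono[OF z(1) norm_ge_zero[of f]] by simp
    ultimately have "\<bar>f x1 - u f\<bar> \<le> 1 + 4 * norm f"
      by (simp add: x1_def blinfun.bilinear_simps)
    then show "(f x1 - u f)\<^sup>2 \<le> (1 + 4 * norm f)\<^sup>2" by (metis abs_ge_zero power2_abs power_mono)
  qed
  ultimately have "m x1 \<le> C"
    unfolding m_def C_def using M by (intro add_mono mult_left_mono divide_right_mono) auto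
  then have "l * m x1 \<le> l * C" using l by (intro mult_left_mono) auto
  moreover have "a x1 \<ge> u a - e + 2 * norm a"
    using y(2)[of a] c z(2) by (auto simp: x1_def blinfun.bilinear_simps)
  ultimately show "\<exists>x. u a + 2 * norm a - l * C - e \<le> a x - l * m x"
    by (intro exI[of _ x1]) linarith
qed

lemma convex_on_penalised_square:
  fixes c :: "('v::real_normed_vector \<Rightarrow>\<^sub>L real) \<Rightarrow> real"
  assumes M: "M \<ge> 0" and F: "finite F"
  shows "convex_on UNIV (\<lambda>x. (norm x)\<^sup>2 / 2 + M * (\<Sum>f\<in>F. (blinfun_apply f x - c f)\<^sup>2))"
proof -
  have "convex_on UNIV (\<lambda>x. (blinfun_apply f x - c f)\<^sup>2)" for f :: "'v \<Rightarrow>\<^sub>L real"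
  proof -
    have "(blinfun_apply f (s *\<^sub>R x + t *\<^sub>R y) - c f)\<^sup>2
        \<le> s * (blinfun_apply f x - c f)\<^sup>2 + t * (blinfun_apply f y - c f)\<^sup>2"
      if "s \<ge> 0" "t \<ge> 0" "s + t = 1" for s t x y
    proof -
      have "blinfun_apply f (s *\<^sub>R x + t *\<^sub>R y) - c f
          = s * (blinfun_apply f x - c f) + t * (blinfun_apply f y - c f)"
        using that(3) by (simp add: blinfun.bilinear_simps algebra_simps flip: distrib_right)
      then show ?thesis using power2_convex_combo[OF that] by simp
    qed
    then show ?thesis by (auto simp: convex_on_def)
  qed
  note sq = this
  have "convex_on UNIV (\<lambda>x. \<Sum>f\<in>F. (blinfun_apply f x - c f)\<^sup>2)"
    using F by (induction F) (simp_all add: convex_on_add sq convex_on_const)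
  then have "convex_on UNIV (\<lambda>x. (1 / 2) * (norm (x - 0))\<^sup>2 + M * (\<Sum>f\<in>F. (blinfun_apply f x - c f)\<^sup>2))"
    using M by (intro convex_on_add convex_on_cmul convex_on_power2 convex_on_norm_diff) auto
  then show ?thesis by simp
qed

text \<open>Take a near-minimiser \<open>(x, x')\<close> for \<open>l * m\<close> and its conjugate
  \<open>q\<close>, tilted by \<open>v\<close>, and a contact point within \<open>t\<close> of it.
  With \<open>a = v - x'\<close>, membership of \<open>(u, v)\<close> in the closure gives
  \<open>a x \<le> u a\<close> up to a multiple of \<open>t\<close>. Two lower bounds for
  \<open>q a\<close> then separate the unknowns: the one with the gain \<open>2 * norm a\<close>
  forces \<open>norm a\<close> to be of order \<open>l\<close>, the other yields
  \<open>m x \<le> B\<close>. Since \<open>B\<close> depends only on \<open>norm u\<close>, the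
  contact points stay bounded as \<open>F\<close> and \<open>e\<close> vary.\<close>

lemma gossez_closure_contact_approx:
  fixes E :: "(('a::banach \<times> 'a dual) \<times> real) set" and u :: "'a bidual"
  assumes E: "strong_epi E" and uv: "(u, v) \<in> gossez_closure (contact E)"
    and F: "finite F" and e: "e > 0"
  shows "\<exists>(y, y')\<in>contact E. norm y \<le> 2 * ((norm u)\<^sup>2 + norm u + 4) + 1 \<and> norm y' \<le> norm v + 1
     \<and> (\<forall>f\<in>F. \<bar>blinfun_apply f y - blinfun_apply u f\<bar> < e) \<and> norm (y' - v) < e"
proof -
  define D where "D = norm u"
  define B where "B = D\<^sup>2 + D + 4"
  define e1 where "e1 = min e 1"
  have e1: "e1 > 0" "e1 \<le> 1" "e1 \<le> e" using e by (auto simp: e1_def)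
  have D: "D \<ge> 0" by (simp add: D_def)
  have B: "B \<ge> 4" using D by (simp add: B_def)
  \<comment> \<open>Once \<open>m x \<le> B\<close> is known, the penalty bounds each squared error
    by \<open>B / M = (e1 / 2)\<^sup>2\<close>.\<close>
  define M where "M = 4 * B / e1\<^sup>2"
  have M: "M > 0" using B e1 by (simp add: M_def)
  define m where "m = (\<lambda>x. (norm x)\<^sup>2 / 2 + M * (\<Sum>f\<in>F. (blinfun_apply f x - u f)\<^sup>2))"
  define C where "C = (norm u + 4)\<^sup>2 / 2 + M * (\<Sum>f\<in>F. (1 + 4 * norm f)\<^sup>2)"
  have C: "C \<ge> 0" using M by (simp add: C_def sum_nonneg)
  define N where "N = 1 + (\<Sum>f\<in>F. norm f)"
  have N: "N \<ge> 1" by (simp add: N_def sum_nonneg)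
  \<comment> \<open>\<open>l\<close> is fixed after \<open>M\<close>, since \<open>C\<close>
    contains \<open>M\<close>. The sum collects what gets multiplied by \<open>l\<close> below: C +
    3 + D for the bound on \<open>norm a\<close>, 1 for \<open>t < l\<close>, and \<open>N\<close>
    for the values of members of \<open>F\<close> at \<open>y - x\<close>.\<close>
  define S where "S = C + 4 + D + N"
  define l where "l = e1 / (2 * S)"
  have S: "S > 0" using C D N by (simp add: S_def)
  have lS: "l * (C + 4 + D + N) = e1 / 2" using S unfolding l_def S_def[symmetric] by simp
  have l: "l > 0" using e1 S by (simp add: l_def)
  have lC: "l * (C + 3 + D) + l + l * N = e1 / 2" using lS by (simp add: algebra_simps)
  have l0: "l * (C + 3 + D) \<ge> 0" "l * N \<ge> 0" using l C D N by simp_all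
  then have l1: "l \<le> 1 / 2" "l * N \<le> e1 / 2" using lC e1 l by linarith+
  define t where "t = l / 4"
  have t: "t > 0" "t \<le> 1" using l l1 by (auto simp: t_def)
  define \<epsilon> where "\<epsilon> = (t / 6)\<^sup>2"
  have \<epsilon>: "\<epsilon> > 0" "6 * sqrt \<epsilon> = t" using t by (auto simp: \<epsilon>_def)
  have \<epsilon>l: "\<epsilon> \<le> l"
  proof -
    have "\<epsilon> = t * t / 36" by (simp add: \<epsilon>_def power2_eq_square)
    also have "\<dots> \<le> t * 1 / 36" using t by (intro divide_right_mono mult_left_mono) auto
    also have "\<dots> \<le> l" using l by (simp add: t_def)
    finally show ?thesis .
  qed
  define q :: "'a dual \<Rightarrow> real" where "q = (\<lambda>b. SUP x. blinfun_apply b x - l * m x)"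
  have m_ge: "m x \<ge> (norm x)\<^sup>2 / 2" for x
    using M by (simp add: m_def sum_nonneg)
  have qb: "b x - l * m x \<le> (norm b)\<^sup>2 / (2 * l)" for b :: "'a dual" and x
  proof -
    have "l * ((norm x)\<^sup>2 / 2) \<le> l * m x" by (rule mult_left_mono[OF m_ge]) (use l in simp)
    then have "l / 2 * (norm x)\<^sup>2 \<le> l * m x" by simp
    with blinfun_young(2)[OF l, where b = b and x = x] show ?thesis by linarith
  qed
  have bdd: "bdd_above (range (\<lambda>x. blinfun_apply b x - l * m x))" for b :: "'a dual"
    using qb by (intro bdd_aboveI2)
  have qge: "b x - l * m x \<le> q b" for b :: "'a dual" and x
    unfolding q_def by (rule cSUP_upper[OF UNIV_I bdd])
  have qle: "q b \<le> (norm b)\<^sup>2 / (2 * l)" for b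
    unfolding q_def by (rule cSUP_least) (use qb in auto)
  have qcvx: "convex_on UNIV q"
  proof -
    have "q (s *\<^sub>R b + r *\<^sub>R c) \<le> s * q b + r * q c" if "s \<ge> 0" "r \<ge> 0" "s + r = 1" for s r and b c :: "'a dual"
    proof (subst q_def, rule cSUP_least)
      fix x
      have r: "r = 1 - s" using that(3) by simp
      have "(s *\<^sub>R b + r *\<^sub>R c) x - l * m x = s * (b x - l * m x) + r * (c x - l * m x)"
        unfolding r by (simp add: blinfun.bilinear_simps algebra_simps)
      also have "\<dots> \<le> s * q b + r * q c" using that qge by (intro add_mono mult_left_mono) auto
      finally show "(s *\<^sub>R b + r *\<^sub>R c) x - l * m x \<le> s * q b + r * q c" .
    qed simp
    then show ?thesis by (auto simp: convex_on_def)
  qed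
  define k where "k = (\<lambda>x. l * m x + (- v x + 0))"
  define kc where "kc = (\<lambda>b. q (b + v))"
  have "\<exists>x x' r. ((x, x'), r) \<in> E \<and> r + k x + kc (- x') \<le> \<epsilon>"
  proof (rule fenchel_gap_zero[OF E])
    show "convex_on UNIV k"
      unfolding k_def m_def using l M F
      by (intro convex_on_add[OF convex_on_cmul convex_on_affine_functional] convex_on_penalised_square)
        (auto intro!: linearI simp: blinfun.bilinear_simps)
    show "convex_on UNIV kc"
    proof -
      have "q (s *\<^sub>R b + r *\<^sub>R c + v) \<le> s * q (b + v) + r * q (c + v)"
        if "s \<ge> 0" "r \<ge> 0" "s + r = 1" for s r b c
      proof -
        have "s *\<^sub>R b + r *\<^sub>R c + v = s *\<^sub>R (b + v) + r *\<^sub>R (c + v)"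
          using that(3) by (simp add: algebra_simps flip: scaleR_add_left)
        then show ?thesis using qcvx that by (simp add: convex_on_def)
      qed
      then show ?thesis by (auto simp: convex_on_def kc_def)
    qed
    show "\<exists>x. blinfun_apply a x - k x \<ge> kc a - d" if "d > 0" for a d
    proof (rule ccontr)
      assume "\<not> ?thesis"
      then have "a x - k x < kc a - d" for x by (simp add: not_le)
      then have "(a + v) x - l * m x \<le> kc a - d" for x
        by (smt (verit) k_def blinfun.add_left)
      then have "q (a + v) \<le> kc a - d" unfolding q_def by (intro cSUP_least) auto
      with that show False by (simp add: kc_def)
    qed
    show "\<exists>K. \<forall>x. norm x \<le> R \<longrightarrow> k x \<le> K" for R
    proof (intro exI allI impI)
      fix x :: 'a assume x: "norm x \<le> R"
      have "(\<Sum>f\<in>F. (blinfun_apply f x - u f)\<^sup>2) \<le> (\<Sum>f\<in>F. (norm f * R + \<bar>u f\<bar>)\<^sup>2)"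
      proof (rule sum_mono)
        fix f assume "f \<in> F"
        have "\<bar>f x\<bar> \<le> norm f * R"
          using norm_blinfun[of f x] mult_left_mono[OF x norm_ge_zero[of f]] by simp
        then have "\<bar>f x - u f\<bar> \<le> norm f * R + \<bar>u f\<bar>" by linarith
        then show "(f x - u f)\<^sup>2 \<le> (norm f * R + \<bar>u f\<bar>)\<^sup>2" by (metis abs_ge_zero power2_abs power_mono)
      qed
      then have "m x \<le> R\<^sup>2 / 2 + M * (\<Sum>f\<in>F. (norm f * R + \<bar>u f\<bar>)\<^sup>2)"
        unfolding m_def using x M by (intro add_mono divide_right_mono power_mono mult_left_mono) auto
      then have "l * m x \<le> l * (R\<^sup>2 / 2 + M * (\<Sum>f\<in>F. (norm f * R + \<bar>u f\<bar>)\<^sup>2))"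
        using l by (intro mult_left_mono) auto
      moreover have "- v x \<le> norm v * R"
        using norm_blinfun[of v x] mult_left_mono[OF x norm_ge_zero[of v]] by simp
      ultimately show "k x \<le> l * (R\<^sup>2 / 2 + M * (\<Sum>f\<in>F. (norm f * R + \<bar>u f\<bar>)\<^sup>2)) + norm v * R"
        by (simp add: k_def)
    qed
    show "\<exists>K. \<forall>a. norm a \<le> R \<longrightarrow> kc a \<le> K" for R
    proof (intro exI allI impI)
      fix a :: "'a dual" assume a: "norm a \<le> R"
      have "norm (a + v) \<le> R + norm v" using norm_triangle_ineq[of a v] a by linarith
      then have "(norm (a + v))\<^sup>2 / (2 * l) \<le> (R + norm v)\<^sup>2 / (2 * l)"
        using l by (intro divide_right_mono power_mono) auto
      then show "kc a \<le> (R + norm v)\<^sup>2 / (2 * l)" using qle[of "a + v"] by (simp add: kc_def)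
    qed
  qed (rule \<epsilon>(1))
  then obtain x x' r where E1: "((x, x'), r) \<in> E" and gap: "r + k x + kc (- x') \<le> \<epsilon>" by blast
  define a where "a = v - x'"
  have gap': "r + l * m x - v x + q a \<le> \<epsilon>"
    using gap by (simp add: k_def kc_def a_def)
  have rx: "x' x \<le> r" using strong_epi_ge[OF E E1] .
  have "r \<le> coupling (x, x') + \<epsilon>"
    using gap' qge[of a x] by (simp add: a_def coupling_def blinfun.bilinear_simps)
  then obtain p where p: "p \<in> contact E" "norm (p - (x, x')) \<le> t"
    using strong_epi_bronsted_rockafellar[OF E E1 _ \<epsilon>(1)] \<epsilon>(2) by auto
  obtain y y' where y: "p = (y, y')" by (cases p)
  define z where "z = y - x"
  define d where "d = x' - y'"
  have z: "norm z \<le> t" and d: "norm d \<le> t"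
    using p(2) norm_fst_le[of "y - x" "y' - x'"] norm_snd_le[of "y' - x'" "y - x"]
    by (auto simp: y z_def d_def norm_minus_commute)
  have "(u - canon y) (v - y') \<ge> 0"
    using uv p(1) by (auto simp: gossez_closure_def y)
  moreover have "v - y' = a + d" "y = x + z" by (auto simp: a_def d_def z_def)
  ultimately have "a x + a z + d x + d z \<le> u a + u d"
    by (simp add: blinfun.bilinear_simps)
  moreover have "- (norm a * t) \<le> a z"
    using norm_blinfun[of a z] mult_left_mono[OF z norm_ge_zero[of a]] by (simp add: abs_le_iff)
  moreover have "- (t * norm x) \<le> d x"
    using norm_blinfun[of d x] mult_right_mono[OF d norm_ge_zero[of x]] by (simp add: abs_le_iff)
  moreover have "- t \<le> d z"
  proof -
    have "norm d * norm z \<le> t * 1" using d z t by (intro mult_mono) auto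
    then show ?thesis using norm_blinfun[of d z] by (simp add: abs_le_iff)
  qed
  moreover have "u d \<le> D * t"
    using norm_blinfun[of u d] mult_left_mono[OF d norm_ge_zero[of u]] by (simp add: abs_le_iff D_def)
  ultimately have ax: "a x \<le> u a + t * (norm a + norm x + 1 + D)"
    by (simp add: algebra_simps)
  have key: "l * m x + q a - u a \<le> l + t * (norm a + norm x + 1 + D)"
    using gap' rx ax \<epsilon>l by (simp add: a_def blinfun.bilinear_simps)
  have nx: "norm x \<le> m x + 1 / 2"
  proof -
    have "0 \<le> (norm x - 1)\<^sup>2" by simp
    then show ?thesis using m_ge[of x] by (simp add: power2_eq_square algebra_simps)
  qed
  have m0: "m x \<ge> 0" by (rule order_trans[OF _ m_ge]) simp
  have "q a \<ge> u a + 2 * norm a - l * C"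
  proof (rule field_le_epsilon)
    fix c :: real assume "c > 0"
    then obtain x1 where "u a + 2 * norm a - l * C - c \<le> a x1 - l * m x1"
      using conjugate_penalised_square_lower(2)[OF F less_imp_le[OF M] l, of c u a]
      unfolding m_def C_def by blast
    then show "u a + 2 * norm a - l * C \<le> q a + c" using qge[of a x1] by linarith
  qed
  \<comment> \<open>One of the two copies of \<open>norm a\<close> absorbs
    \<open>t * norm a\<close>, and \<open>l * m x\<close> together with \<open>l\<close> absorbs
    \<open>t * norm x\<close>; the other copy is left to be estimated.\<close>
  then have "l * m x + 2 * norm a \<le> l * C + l + t * (norm a + norm x + 1 + D)" using key by linarith
  moreover have "t * norm a \<le> norm a" using t by (intro mult_left_le_one_le) auto
  moreover have "t * norm x \<le> l * m x + l"
  proof -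
    have "t * norm x \<le> t * (m x + 1 / 2)" using nx t by (intro mult_left_mono) auto
    also have "\<dots> \<le> l * (m x + 1)" unfolding t_def using l m0 by (intro mult_mono) auto
    finally show ?thesis by (simp add: algebra_simps)
  qed
  moreover have "t * (1 + D) \<le> l * (1 + D)" using l D by (intro mult_right_mono) (auto simp: t_def)
  ultimately have na: "norm a \<le> l * (C + 3 + D)" by (simp add: algebra_simps)
  have na': "norm a + l + l * N \<le> e1 / 2" using na lC by linarith
  have na1: "norm a \<le> 1" using na' l l0(2) e1 by linarith
  have "q a \<ge> u a - l * (D\<^sup>2 / 2 + 1)"
  proof -
    obtain x1 where "u a - l * ((norm u)\<^sup>2 / 2 + 1) \<le> a x1 - l * m x1"
      using conjugate_penalised_square_lower(1)[OF F less_imp_le[OF M] l, of u a]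
      unfolding m_def by blast
    then show ?thesis using qge[of a x1] by (simp add: D_def)
  qed
  then have "l * m x \<le> l * (D\<^sup>2 / 2 + 1) + l + t * (norm a + norm x + 1 + D)" using key by linarith
  also have "\<dots> \<le> l * (D\<^sup>2 / 2 + 1) + l + t * (1 + (m x + 1 / 2) + 1 + D)"
    using na1 nx t by (intro add_left_mono mult_left_mono) auto
  also have "\<dots> = l * (D\<^sup>2 / 2 + 2 + (m x + 5 / 2 + D) / 4)" by (simp add: t_def algebra_simps add_divide_distrib)
  finally have "m x \<le> D\<^sup>2 / 2 + 2 + (m x + 5 / 2 + D) / 4" using l by simp
  then have "4 * m x \<le> 2 * D\<^sup>2 + 8 + m x + 5 / 2 + D" by (simp add: field_simps)
  moreover have "D\<^sup>2 \<ge> 0" by simp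
  ultimately have mB: "m x \<le> B" using D unfolding B_def by linarith
  have "norm x \<le> 2 * B" using nx mB B by linarith
  then have 1: "norm y \<le> 2 * B + 1"
    using z t norm_triangle_ineq[of x z] by (simp add: z_def)
  have yv: "norm (y' - v) \<le> norm a + t"
    using norm_triangle_ineq[of a d] d by (simp add: a_def d_def norm_minus_commute)
  have te: "t < l" using l by (simp add: t_def)
  have 2: "norm (y' - v) < e1"
    using yv te na' l l0(2) e1 by linarith
  then have 3: "norm y' \<le> norm v + 1"
    using norm_triangle_ineq[of "y' - v" v] e1 by simp
  have "\<bar>f y - u f\<bar> < e" if f: "f \<in> F" for f
  proof -
    have "(f x - u f)\<^sup>2 \<le> (\<Sum>f\<in>F. (blinfun_apply f x - u f)\<^sup>2)"
      by (rule member_le_sum[OF f _ F]) auto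
    then have "M * (f x - u f)\<^sup>2 \<le> M * (\<Sum>f\<in>F. (blinfun_apply f x - u f)\<^sup>2)"
      using M by (intro mult_left_mono) auto
    also have "\<dots> \<le> m x" by (simp add: m_def)
    finally have "M * (f x - u f)\<^sup>2 \<le> m x" .
    then have "M * (f x - u f)\<^sup>2 \<le> B" using mB by linarith
    then have "(f x - u f)\<^sup>2 \<le> B / M" using M by (simp only: pos_le_divide_eq mult.commute)
    also have "B / M = (e1 / 2)\<^sup>2"
    proof -
      have "B \<noteq> 0" "e1 \<noteq> 0" using B e1 by auto
      then show ?thesis by (simp add: M_def power_divide)
    qed
    finally have "\<bar>f x - u f\<bar> \<le> \<bar>e1 / 2\<bar>" by (simp only: abs_le_square_iff)
    then have "\<bar>f x - u f\<bar> \<le> e1 / 2" using e1 by simp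
    moreover have "\<bar>f z\<bar> < e1 / 2"
    proof -
      have "norm f \<le> N"
        unfolding N_def using member_le_sum[OF f _ F, of norm] by simp
      then have "norm f * norm z \<le> N * t" using z N by (intro mult_mono) auto
      also have "\<dots> < N * l" using te N by (intro mult_strict_left_mono) auto
      also have "\<dots> \<le> e1 / 2" using l1 by (simp add: mult.commute)
      finally show ?thesis using norm_blinfun[of f z] by simp
    qed
    moreover have "f y = f x + f z" by (simp add: z_def blinfun.bilinear_simps)
    ultimately show ?thesis using e1 by linarith
  qed
  then show ?thesis using p(1) 1 2 3 e1 unfolding y B_def D_def by (intro bexI[of _ "(y, y')"]) auto
qed

text \<open>At the midpoint of two contact points \<open>coupling\<close> is at most the mean of the
  two couplings, and the difference is a quarter of the monotonicity product.\<close>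

lemma contact_monotone:
  assumes E: "strong_epi E" shows "monotone_op (contact E)"
proof -
  have "(x' - y') (x - y) \<ge> 0"
    if "((x, x'), blinfun_apply x' x) \<in> E" "((y, y'), blinfun_apply y' y) \<in> E" for x y x' y'
  proof -
    have "((1/2) *\<^sub>R x' + (1/2) *\<^sub>R y') ((1/2) *\<^sub>R x + (1/2) *\<^sub>R y) \<le> 1/2 * x' x + 1/2 * y' y"
      by (rule strong_epi_ge[OF E], rule convex_combo_pair[OF strong_epi_convex[OF E] that]) auto
    then show ?thesis by (simp add: blinfun.bilinear_simps field_simps)
  qed
  then show ?thesis by (auto simp: monotone_op_def contact_def coupling_def)
qed

text \<open>For a closure point of X the point itself can be the centre of a proximal step. The
  closure inequality, read at a contact point close to the near-minimiser, bounds
  \<open>(x' - v) (x - x0)\<close> from below up to small terms, so the squares in the proximal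
  inequality are small and contact points accumulate at the centre.\<close>

lemma contact_closure_canon:
  assumes E: "strong_epi E" and xv: "(canon x0, v) \<in> gossez_closure (contact E)"
  shows "(x0, v) \<in> contact E"
proof -
  have "closed (contact E)"
  proof -
    have "continuous_on UNIV (\<lambda>p. (p, coupling p))"
      by (intro continuous_intros continuous_on_coupling)
    from closed_vimage[OF strong_epi_closed[OF E] this]
    show ?thesis by (simp add: contact_def vimage_def)
  qed
  moreover have "(x0, v) \<in> closure (contact E)"
  proof (clarsimp simp: closure_approachable)
    fix d :: real assume d: "d > 0"
    define \<tau> where "\<tau> = d / 6"
    have \<tau>: "\<tau> > 0" using d by (simp add: \<tau>_def)
    define \<eta> where "\<eta> = (\<tau> / 6)\<^sup>2"
    have \<eta>: "\<eta> > 0" "6 * sqrt \<eta> = \<tau>" using \<tau> by (auto simp: \<eta>_def)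
    have \<eta>\<tau>: "\<eta> \<le> \<tau>\<^sup>2" by (simp add: \<eta>_def power_divide)
    obtain x x' r where E1: "((x, x'), r) \<in> E" and
      le: "r - v x - x' x0 + v x0 + 1 / 2 * (norm (x - x0))\<^sup>2 + (norm (x' - v))\<^sup>2 / (2 * 1) \<le> \<eta>"
      using strong_epi_prox[OF E zero_less_one \<eta>(1), of v x0] by blast
    have rx: "x' x \<le> r" using strong_epi_ge[OF E E1] .
    define s where "s = norm (x - x0)"
    define t where "t = norm (x' - v)"
    have "(x' - v) (x - x0) \<ge> - (1 / 2 * (norm (x - x0))\<^sup>2 + (norm (x' - v))\<^sup>2 / (2 * 1))"
      by (rule blinfun_young) simp
    then have "r \<le> coupling (x, x') + \<eta>"
      using le by (simp add: coupling_def blinfun.bilinear_simps)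
    then obtain p where p: "p \<in> contact E" "norm (p - (x, x')) \<le> \<tau>"
      using strong_epi_bronsted_rockafellar[OF E E1 _ \<eta>(1)] \<eta>(2) by auto
    obtain y y' where y: "p = (y, y')" by (cases p)
    define z where "z = y - x"
    define w where "w = y' - x'"
    have z: "norm z \<le> \<tau>" and w: "norm w \<le> \<tau>"
      using p(2) norm_fst_le[of "y - x" "y' - x'"] norm_snd_le[of "y' - x'" "y - x"]
      by (auto simp: y z_def w_def)
    have "(canon x0 - canon y) (v - y') \<ge> 0"
      using xv p(1) by (auto simp: gossez_closure_def y)
    moreover have "y = x + z" "y' = x' + w" by (auto simp: w_def z_def)
    ultimately have "(x' - v) (x - x0) + (x' - v) z + w (x - x0) + w z \<ge> 0"
      by (simp add: blinfun.bilinear_simps)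
    moreover have "(x' - v) z \<le> t * \<tau>"
      using norm_blinfun[of "x' - v" z] mult_left_mono[OF z norm_ge_zero[of "x' - v"]] by (simp add: t_def)
    moreover have "w (x - x0) \<le> \<tau> * s"
      using norm_blinfun[of w "x - x0"] mult_right_mono[OF w norm_ge_zero[of "x - x0"]] by (simp add: s_def)
    moreover have "w z \<le> \<tau> * \<tau>"
    proof -
      have "norm w * norm z \<le> \<tau> * \<tau>" using w z \<tau> by (intro mult_mono) auto
      then show ?thesis using norm_blinfun[of w z] by simp
    qed
    ultimately have "(x' - v) (x - x0) \<ge> - (t * \<tau> + \<tau> * s + \<tau> * \<tau>)" by linarith
    then have "s\<^sup>2 / 2 + t\<^sup>2 / 2 \<le> \<eta> + (t * \<tau> + \<tau> * s + \<tau> * \<tau>)"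
      using le rx by (simp add: blinfun.bilinear_simps s_def t_def)
    \<comment> \<open>These squares absorb the cross terms \<open>\<tau> * s\<close> and
      \<open>t * \<tau>\<close> into quarters of s^2 and t^2.\<close>
    moreover have "0 \<le> (s / 2 - \<tau>)\<^sup>2" "0 \<le> (t / 2 - \<tau>)\<^sup>2" by auto
    ultimately have "s\<^sup>2 + t\<^sup>2 \<le> 16 * \<tau>\<^sup>2"
      using \<eta>\<tau> by (simp add: power2_eq_square algebra_simps)
    also have "\<dots> = (4 * \<tau>)\<^sup>2" by (simp add: power2_eq_square)
    finally have "(norm ((x, x') - (x0, v)))\<^sup>2 \<le> (4 * \<tau>)\<^sup>2"
      by (simp add: norm_Pair s_def t_def)
    then have "norm ((x, x') - (x0, v)) \<le> 4 * \<tau>"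
      by (rule power2_le_imp_le) (use \<tau> in simp)
    then have "dist p (x0, v) \<le> \<tau> + 4 * \<tau>"
      using p(2) dist_triangle[of p "(x0, v)" "(x, x')"] unfolding dist_norm by linarith
    then have "dist p (x0, v) < d" using d by (simp add: \<tau>_def)
    then show "\<exists>y\<in>contact E. dist y (x0, v) < d" using p(1) by blast
  qed
  ultimately show ?thesis by simp
qed

text \<open>Every monotone extension lies, after embedding X, in Gossez's closure, so maximality is
  the case of closure points in X. For the density clause a single radius, depending on the closure
  point alone, serves all \<open>F\<close> and \<open>e\<close>.\<close>

theorem strong_epi_gossez_D:
  fixes E :: "(('a::banach \<times> 'a dual) \<times> real) set"
  assumes E: "strong_epi E" shows "gossez_D (contact E)"
  unfolding gossez_D_def maximal_monotone_def
proof (intro conjI allI impI ballI contact_monotone[OF E])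
  fix H assume H: "monotone_op H \<and> contact E \<subseteq> H"
  have "(x, v) \<in> contact E" if "(x, v) \<in> H" for x v
  proof (rule contact_closure_canon[OF E])
    show "(canon x, v) \<in> gossez_closure (contact E)"
      using H that by (fastforce simp: gossez_closure_def monotone_op_def blinfun.bilinear_simps)
  qed
  then show "H = contact E" using H by auto
next
  fix p assume p: "p \<in> gossez_closure (contact E)"
  obtain u v where uv: "p = (u, v)" by (cases p)
  define r where "r = 2 * ((norm u)\<^sup>2 + norm u + 4) + 1 + (norm v + 1)"
  show "\<exists>r. wsn_limit_of {(y, y') \<in> contact E. norm y \<le> r \<and> norm y' \<le> r} p"
    unfolding wsn_limit_of_def
  proof (intro exI[of _ r] allI impI)
    fix F :: "'a dual set" and e :: real
    assume F: "finite F" and e: "e > 0"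
    obtain y y' where y: "(y, y') \<in> contact E" "norm y \<le> 2 * ((norm u)\<^sup>2 + norm u + 4) + 1"
      "norm y' \<le> norm v + 1" "\<forall>f\<in>F. \<bar>blinfun_apply f y - blinfun_apply u f\<bar> < e" "norm (y' - v) < e"
      using gossez_closure_contact_approx[OF E p[unfolded uv] F e] by blast
    have "norm y \<le> r"
      unfolding r_def by (rule add_increasing2[OF _ y(2)]) simp
    moreover have "norm y' \<le> r"
      unfolding r_def by (rule add_increasing[OF _ y(3)]) simp
    ultimately show "\<exists>(y, y')\<in>{(y, y') \<in> contact E. norm y \<le> r \<and> norm y' \<le> r}.
        (\<forall>f\<in>F. \<bar>blinfun_apply (canon y) f - blinfun_apply (fst p) f\<bar> < e) \<and> norm (y' - snd p) < e"
      using y by (intro bexI[of _ "(y, y')"]) (auto simp: uv)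
  qed
qed

section \<open>Openness of convex images\<close>

text \<open>The dyadic weights add up to 1 - (1/2)^n; the missing weight is given to
  \<open>k0\<close>, so that 0 need not belong to \<open>K\<close>.\<close>

lemma convex_dyadic_combo:
  assumes K: "convex K" and k0: "k0 \<in> K" and f: "\<And>i. f i \<in> K"
  shows "(\<Sum>i<n. (1/2::real) ^ Suc i *\<^sub>R f i) + (1/2) ^ n *\<^sub>R k0 \<in> K"
  using f
proof (induction n arbitrary: f)
  case 0
  then show ?case using k0 by simp
next
  case (Suc n)
  have "(1/2) *\<^sub>R f 0 + (1/2) *\<^sub>R ((\<Sum>i<n. (1/2::real) ^ Suc i *\<^sub>R f (Suc i)) + (1/2) ^ n *\<^sub>R k0) \<in> K"
    by (rule convexD[OF K Suc.prems Suc.IH]) (auto intro: Suc.prems)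
  then show ?case
    by (subst sum.lessThan_Suc_shift) (simp add: scaleR_add_right scaleR_sum_right add.assoc)
qed

text \<open>Successive approximation: if the image is dense in a ball, doubling the remaining error and
  approximating again writes a point of the half ball as a dyadic convex series in the image.\<close>
lemma convex_image_ball_of_dense:
  fixes \<Lambda> :: "'u::banach \<Rightarrow> 'w::real_normed_vector"
  assumes bl: "bounded_linear \<Lambda>" and L: "subspace L" and K: "convex K" "closed K"
    and Kb: "\<And>k. k \<in> K \<Longrightarrow> norm k \<le> B" and KL: "\<Lambda> ` K \<subseteq> L" and k0: "k0 \<in> K"
    and dense: "\<And>w. w \<in> L \<Longrightarrow> norm w < \<rho> \<Longrightarrow> w \<in> closure (\<Lambda> ` K)"
    and w: "w \<in> L" "norm w < \<rho> / 2"
  shows "w \<in> \<Lambda> ` K"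
proof -
  interpret \<Lambda>: bounded_linear \<Lambda> by (rule bl)
  define Z where "Z = {w \<in> L. norm w < \<rho> / 2}"
  have \<rho>: "\<rho> > 0" using w(2) norm_ge_zero[of w] by linarith
  have "\<exists>k\<in>K. 2 *\<^sub>R z - \<Lambda> k \<in> Z" if z: "z \<in> Z" for z
  proof -
    have "2 *\<^sub>R z \<in> closure (\<Lambda> ` K)"
      using z by (intro dense) (auto simp: Z_def intro: subspace_scale[OF L])
    moreover have "\<rho> / 2 > 0" using \<rho> by simp
    ultimately obtain k where k: "k \<in> K" "dist (\<Lambda> k) (2 *\<^sub>R z) < \<rho> / 2"
      unfolding closure_approachable by blast
    have "2 *\<^sub>R z - \<Lambda> k \<in> L"
      using z k KL by (intro subspace_diff[OF L] subspace_scale[OF L]) (auto simp: Z_def)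
    then show ?thesis using k by (intro bexI[of _ k]) (auto simp: Z_def dist_norm norm_minus_commute)
  qed
  then obtain \<kappa> where \<kappa>: "\<And>z. z \<in> Z \<Longrightarrow> \<kappa> z \<in> K" "\<And>z. z \<in> Z \<Longrightarrow> 2 *\<^sub>R z - \<Lambda> (\<kappa> z) \<in> Z"
    by metis
  \<comment> \<open>\<open>W n\<close> is the error after n terms, magnified by 2^n. That it never
    leaves \<open>Z\<close> makes the true error tend to 0.\<close>
  define W where "W = rec_nat w (\<lambda>_ z. 2 *\<^sub>R z - \<Lambda> (\<kappa> z))"
  have W0: "W 0 = w" and WS: "\<And>n. W (Suc n) = 2 *\<^sub>R W n - \<Lambda> (\<kappa> (W n))"
    by (simp_all add: W_def)
  have WZ: "W n \<in> Z" for n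
    by (induction n) (use w \<kappa>(2) in \<open>auto simp: W0 WS Z_def\<close>)
  define f where "f = (\<lambda>n. \<kappa> (W n))"
  have fK: "f n \<in> K" for n using \<kappa>(1) WZ by (simp add: f_def)
  define S where "S = (\<lambda>n. \<Sum>i<n. (1/2::real) ^ Suc i *\<^sub>R f i)"
  have S: "\<Lambda> (S n) = w - (1/2) ^ n *\<^sub>R W n" for n
  proof (induction n)
    case (Suc n)
    have "\<Lambda> (S (Suc n)) = \<Lambda> (S n) + (1/2) ^ Suc n *\<^sub>R \<Lambda> (f n)"
      by (simp add: S_def \<Lambda>.add \<Lambda>.scaleR)
    also have "\<Lambda> (f n) = 2 *\<^sub>R W n - W (Suc n)" by (simp add: f_def WS)
    finally show ?case using Suc by (simp add: scaleR_diff_right)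
  qed (simp add: S_def W0 \<Lambda>.zero)
  have pow0: "(\<lambda>n. (1/2::real) ^ n) \<longlonglongrightarrow> 0" by (intro LIMSEQ_realpow_zero) auto
  have B: "B \<ge> 0" using Kb[OF k0] norm_ge_zero order_trans by blast
  have "summable (\<lambda>i. (1/2::real) ^ Suc i *\<^sub>R f i)"
  proof (rule summable_comparison_test'[of "\<lambda>i. B * (1/2) ^ i" 0])
    show "summable (\<lambda>i. B * (1/2::real) ^ i)" by (intro summable_mult summable_geometric) simp
    show "norm ((1/2::real) ^ Suc i *\<^sub>R f i) \<le> B * (1/2) ^ i" for i
    proof -
      have "(1/2::real) ^ Suc i * norm (f i) \<le> (1/2) ^ i * B"
        using Kb[OF fK[of i]] by (intro mult_mono) auto
      then show ?thesis by (simp add: mult.commute)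
    qed
  qed
  then obtain k where Sk: "S \<longlonglongrightarrow> k"
    unfolding S_def using summable_LIMSEQ by blast
  have "(\<lambda>n. S n + (1/2) ^ n *\<^sub>R k0) \<longlonglongrightarrow> k + 0 *\<^sub>R k0"
    by (intro tendsto_add Sk tendsto_scaleR pow0 tendsto_const)
  then have "k \<in> K"
    using closed_sequentially[OF K(2), of "\<lambda>n. S n + (1/2) ^ n *\<^sub>R k0" k]
      convex_dyadic_combo[OF K(1) k0 fK] by (simp add: S_def)
  moreover have "\<Lambda> k = w"
  proof (rule LIMSEQ_unique[OF \<Lambda>.tendsto[OF Sk]])
    have "(\<lambda>n. (1/2) ^ n *\<^sub>R W n) \<longlonglongrightarrow> 0"
    proof (rule Lim_null_comparison)
      show "\<forall>\<^sub>F n in sequentially. norm ((1/2) ^ n *\<^sub>R W n) \<le> (1/2) ^ n * (\<rho> / 2)"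
        using WZ by (intro always_eventually allI) (auto simp: Z_def intro!: mult_left_mono less_imp_le)
      show "(\<lambda>n. (1/2) ^ n * (\<rho> / 2)) \<longlonglongrightarrow> 0" by (rule tendsto_mult_left_zero[OF pow0])
    qed
    from tendsto_diff[OF tendsto_const[of w] this] show "(\<lambda>n. \<Lambda> (S n)) \<longlonglongrightarrow> w"
      by (simp add: S)
  qed
  ultimately show ?thesis by blast
qed

text \<open>Applied to the convex process with graph
  \<open>{(w, k). k \<in> K \<and> \<Lambda> k = w}\<close>.\<close>
lemma robinson_ursescu:
  fixes \<Lambda> :: "'u::banach \<Rightarrow> 'w::banach"
  assumes bl: "bounded_linear \<Lambda>" and L: "subspace L" "closed L" and K: "convex K" "closed K"
    and KL: "\<Lambda> ` K \<subseteq> L" and core: "\<And>w. w \<in> L \<Longrightarrow> \<exists>t>0. t *\<^sub>R w \<in> \<Lambda> ` K"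
  shows "\<exists>d>0. \<exists>N. \<forall>w\<in>L. norm w \<le> d \<longrightarrow> (\<exists>k\<in>K. norm k \<le> N \<and> \<Lambda> k = w)"
proof -
  interpret \<Lambda>: bounded_linear \<Lambda> by (rule bl)
  have L0: "0 \<in> L" by (rule subspace_0[OF L(1)])
  obtain k0 where k0: "k0 \<in> K" "\<Lambda> k0 = 0" using core[OF L0] by auto
  define Kn where "Kn = (\<lambda>n::nat. K \<inter> cball 0 (real n))"
  define C where "C = (\<lambda>n. closure (\<Lambda> ` Kn n))"
  have KnI: "k \<in> Kn n" if "k \<in> K" "norm k \<le> real n" for k n using that by (simp add: Kn_def)
  have Kn: "convex (Kn n)" "closed (Kn n)" for n
    using K by (auto simp: Kn_def intro: convex_Int)
  have Ccvx: "convex (C n)" for n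
    unfolding C_def by (intro convex_closure convex_linear_image Kn \<Lambda>.linear_axioms)
  have CI: "\<Lambda> k \<in> C n" if "k \<in> Kn n" for k n
    unfolding C_def using that by (intro subsetD[OF closure_subset] imageI)
  \<comment> \<open>\<open>G n\<close> is the part in \<open>L\<close> of the dilate of
    \<open>C n\<close> by n + 1. Baire's theorem is applied to these sets inside the complete space
    \<open>L\<close>.\<close>
  define G where "G = (\<lambda>n. L \<inter> (\<lambda>w. (1 / (real n + 1)) *\<^sub>R w) -` C n)"
  have cov: "L \<subseteq> (\<Union>n. G n)"
  proof
    fix w assume w: "w \<in> L"
    obtain t k where t: "t > 0" "k \<in> K" "\<Lambda> k = t *\<^sub>R w" using core[OF w] by auto
    obtain n :: nat where n: "real n \<ge> max (1 / t) (max (norm k) (norm k0))"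
      using real_arch_simple by blast
    \<comment> \<open>Then \<open>c * t = 1 / (real n + 1)\<close>. The weight left over goes to
      \<open>k0\<close>, which \<open>\<Lambda>\<close> maps to 0.\<close>
    define c where "c = 1 / ((real n + 1) * t)"
    have "1 / t \<le> real n + 1" using n by simp
    then have "1 \<le> (real n + 1) * t" using t(1) by (simp add: field_simps)
    then have c: "0 \<le> c" "c \<le> 1" using t(1) by (auto simp: c_def)
    have "c *\<^sub>R k + (1 - c) *\<^sub>R k0 \<in> Kn n"
      using n t k0 c by (intro convexD[OF Kn(1)] KnI) auto
    then have "\<Lambda> (c *\<^sub>R k + (1 - c) *\<^sub>R k0) \<in> C n" by (rule CI)
    moreover have "\<Lambda> (c *\<^sub>R k + (1 - c) *\<^sub>R k0) = (1 / (real n + 1)) *\<^sub>R w"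
      using t by (simp add: \<Lambda>.add \<Lambda>.scaleR k0 c_def)
    ultimately show "w \<in> (\<Union>n. G n)" using w by (auto simp: G_def)
  qed
  have "\<exists>n. top_of_set L interior_of G n \<noteq> {}"
  proof (rule ccontr)
    assume "\<not> ?thesis"
    then have empty: "\<And>n. top_of_set L interior_of G n = {}" by blast
    have "top_of_set L interior_of \<Union>(range G) = {}"
    proof (rule Baire_category_alt)
      show "completely_metrizable_space (top_of_set L) \<or> locally_compact_space (top_of_set L) \<and> regular_space (top_of_set L)"
        using L(2) by (intro disjI1 completely_metrizable_space_closedin completely_metrizable_space_euclidean) auto
      show "closedin (top_of_set L) T \<and> top_of_set L interior_of T = {}" if "T \<in> range G" for T
      proof -
        have "closed ((\<lambda>w. (1 / (real n + 1)) *\<^sub>R w) -` C n)" for n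
          by (rule closed_vimage) (auto simp: C_def intro!: continuous_intros)
        then show ?thesis using that empty by (auto simp: G_def closedin_closed_Int)
      qed
    qed auto
    moreover have "\<Union>(range G) = L" using cov by (auto simp: G_def)
    moreover have "top_of_set L interior_of L = L" using interior_of_topspace[of "top_of_set L"] by simp
    ultimately show False using L0 by simp
  qed
  then obtain n w1 where w1: "w1 \<in> top_of_set L interior_of G n" by blast
  then obtain U where U: "openin (top_of_set L) U" "w1 \<in> U" "U \<subseteq> G n"
    by (auto simp: interior_of_def)
  then obtain e where e: "e > 0" "ball w1 e \<inter> L \<subseteq> U"
    by (auto simp: openin_contains_ball)
  have w1L: "w1 \<in> L" using U by (auto simp: G_def)
  define c where "c = real n + 1"
  have c: "c > 0" by (simp add: c_def)
  define w2 where "w2 = (1 / c) *\<^sub>R w1"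
  have w2L: "w2 \<in> L" unfolding w2_def by (rule subspace_scale[OF L(1) w1L])
  have ball2: "w2 + v \<in> C n" if v: "v \<in> L" "norm v < e / c" for v
  proof -
    have "c *\<^sub>R (w2 + v) = w1 + c *\<^sub>R v" using c by (simp add: w2_def scaleR_add_right)
    moreover have "norm (c *\<^sub>R v) < e" using v(2) c by (simp add: field_simps)
    moreover have "w1 + c *\<^sub>R v \<in> L" using w1L v by (intro subspace_add subspace_scale L(1))
    moreover have "w1 + c *\<^sub>R v \<in> ball w1 e" using calculation(2) by (simp add: dist_norm)
    ultimately have "c *\<^sub>R (w2 + v) \<in> G n" using e(2) U(3) by auto
    then show ?thesis using c by (simp add: G_def c_def[symmetric])
  qed
  obtain t k where t: "t > 0" "k \<in> K" "\<Lambda> k = t *\<^sub>R (- w2)"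
    using core[OF subspace_neg[OF L(1) w2L]] by auto
  obtain m :: nat where m: "real m \<ge> max (real n) (max (norm k) (norm k0))"
    using real_arch_simple by blast
  have "Kn n \<subseteq> Kn m" using m by (auto simp: Kn_def)
  then have Cnm: "C n \<subseteq> C m" unfolding C_def by (intro closure_mono image_mono)
  \<comment> \<open>The ball given by Baire's theorem is centred at \<open>w2\<close>. Averaging
    with \<open>\<Lambda> k\<close>, which is - t times \<open>w2\<close>, with the weights t / (1 +
    t) and 1 / (1 + t) recentres it at 0 and multiplies the radius by t / (1 + t).\<close>
  define \<rho> where "\<rho> = (e / c) * (t / (1 + t))"
  have \<rho>: "\<rho> > 0" using e c t by (simp add: \<rho>_def)
  have dense: "w \<in> closure (\<Lambda> ` Kn m)" if w: "w \<in> L" "norm w < \<rho>" for w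
  proof -
    define v where "v = ((1 + t) / t) *\<^sub>R w"
    have "v \<in> L" unfolding v_def by (rule subspace_scale[OF L(1) w(1)])
    moreover have "norm v < e / c"
    proof -
      have "norm v = (1 + t) / t * norm w" using t by (simp add: v_def)
      also have "\<dots> < (1 + t) / t * \<rho>" using w t by (intro mult_strict_left_mono) auto
      also have "\<dots> = e / c" using t by (simp add: \<rho>_def)
      finally show ?thesis .
    qed
    ultimately have "w2 + v \<in> C m" using ball2 Cnm by blast
    moreover have "\<Lambda> k \<in> C m" using t m by (intro CI KnI) auto
    ultimately have "(t / (1 + t)) *\<^sub>R (w2 + v) + (1 / (1 + t)) *\<^sub>R \<Lambda> k \<in> C m"
      using t by (intro convexD[OF Ccvx]) (auto simp flip: add_divide_distrib)
    moreover have "(t / (1 + t)) *\<^sub>R (w2 + v) + (1 / (1 + t)) *\<^sub>R \<Lambda> k = w"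
      using t by (simp add: v_def scaleR_add_right)
    ultimately show ?thesis by (simp add: C_def)
  qed
  have "w \<in> \<Lambda> ` Kn m" if "w \<in> L" "norm w \<le> \<rho> / 3" for w
  proof (rule convex_image_ball_of_dense[OF bl L(1) Kn(1) Kn(2) _ _ _ dense])
    show "norm w < \<rho> / 2" using that \<rho> by simp
    show "k0 \<in> Kn m" using k0 m by (intro KnI) auto
    show "\<Lambda> ` Kn m \<subseteq> L" using KL by (auto simp: Kn_def)
    show "norm k \<le> real m" if "k \<in> Kn m" for k using that by (simp add: Kn_def)
  qed (use that in auto)
  then have "\<forall>w\<in>L. norm w \<le> \<rho> / 3 \<longrightarrow> (\<exists>k\<in>K. norm k \<le> real m \<and> \<Lambda> k = w)"
    by (force simp: Kn_def)
  moreover have "\<rho> / 3 > 0" using \<rho> by simp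
  ultimately show ?thesis by blast
qed

section \<open>Parallel sums\<close>

lemma strong_epi_nonempty: "strong_epi E \<Longrightarrow> E \<noteq> {}"
  by (rule strong_epi_conj[OF _ zero_less_one, where a = 0 and b = 0]) auto

section \<open>Intrinsic core and relative interior\<close>

lemma affine_hull_set_diff:
  fixes D :: "'v::real_vector set"
  assumes u: "u \<in> affine hull D"
  shows "affine hull (set_diff D D) = (\<lambda>p. p - u) ` (affine hull D)"
proof -
  have D: "D \<noteq> {}" using u by auto
  then obtain d0 where d0: "d0 \<in> D" by auto
  have z: "0 \<in> set_diff D D" using d0 unfolding set_diff_def by (intro CollectI exI[of _ d0]) simp
  then have span: "affine hull (set_diff D D) = span (set_diff D D)"
    by (simp add: affine_hull_span_0 hull_inc)
  have dir: "p - d0 \<in> span (set_diff D D)" if p: "p \<in> affine hull D" for p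
  proof -
    have "(\<lambda>x. - d0 + x) ` (D - {d0}) \<subseteq> set_diff D D"
    proof (rule image_subsetI)
      fix x assume "x \<in> D - {d0}"
      then have "x - d0 \<in> set_diff D D" using d0 unfolding set_diff_def by blast
      then show "- d0 + x \<in> set_diff D D" by simp
    qed
    then have "span ((\<lambda>x. - d0 + x) ` (D - {d0})) \<subseteq> span (set_diff D D)" by (rule span_mono)
    moreover obtain v where "v \<in> span ((\<lambda>x. - d0 + x) ` (D - {d0}))" "p = d0 + v"
      using p unfolding affine_hull_span2[OF d0] by blast
    ultimately show ?thesis by auto
  qed
  show ?thesis
  proof
    show "(\<lambda>p. p - u) ` (affine hull D) \<subseteq> affine hull (set_diff D D)"
    proof clarify
      fix p assume "p \<in> affine hull D"
      from span_diff[OF dir[OF this] dir[OF u]] show "p - u \<in> affine hull (set_diff D D)"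
        by (simp add: span)
    qed
    have aff: "affine ((\<lambda>p. p - u) ` (affine hull D))"
    proof -
      have "(\<lambda>p. p - u) ` (affine hull D) = (+) (- u) ` (affine hull D)" by (rule image_cong) auto
      then show ?thesis using affine_translation[of "affine hull D" "- u"] by simp
    qed
    have "set_diff D D \<subseteq> (\<lambda>p. p - u) ` (affine hull D)"
    proof
      fix x assume "x \<in> set_diff D D"
      then obtain a b where ab: "x = a - b" "a \<in> D" "b \<in> D" by (auto simp: set_diff_def)
      have "1 *\<^sub>R a + (- 1) *\<^sub>R b + 1 *\<^sub>R u \<in> affine hull D"
        by (rule mem_affine_3[OF affine_affine_hull hull_inc[OF ab(2)] hull_inc[OF ab(3)] u]) simp
      then show "x \<in> (\<lambda>p. p - u) ` (affine hull D)"
        by (intro image_eqI[of _ _ "a - b + u"]) (auto simp: ab)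
    qed
    then show "affine hull (set_diff D D) \<subseteq> (\<lambda>p. p - u) ` (affine hull D)"
      by (intro hull_minimal aff)
  qed
qed

text \<open>The directions aff (D - D) are the differences p - u with p in aff D, so the condition
  can be read along segments towards points of aff D; the direction 0 puts \<open>u\<close> into
  \<open>D\<close>.\<close>

lemma icr_alt:
  assumes D: "D \<noteq> {}"
  shows "icr D = {u \<in> D. \<forall>p\<in>affine hull D. \<exists>\<delta>>0. \<forall>l. 0 \<le> l \<and> l \<le> \<delta> \<longrightarrow> u + l *\<^sub>R (p - u) \<in> D}"
proof -
  have "u \<in> D" if "u \<in> icr D" for u
  proof -
    obtain d0 where "d0 \<in> D" using D by auto
    then have "0 \<in> affine hull (set_diff D D)"
      unfolding set_diff_def by (intro hull_inc CollectI exI[of _ d0]) simp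
    then show ?thesis using that unfolding icr_def by force
  qed
  moreover have "u \<in> icr D \<longleftrightarrow> (\<forall>p\<in>affine hull D. \<exists>\<delta>>0. \<forall>l. 0 \<le> l \<and> l \<le> \<delta> \<longrightarrow> u + l *\<^sub>R (p - u) \<in> D)"
    if "u \<in> D" for u
    unfolding icr_def affine_hull_set_diff[OF hull_inc[OF that]] by simp
  ultimately show ?thesis by blast
qed

lemma ri_subset_ic:
  assumes D: "D \<noteq> {}"
  shows "ri D \<subseteq> ic D"
proof (cases "closed (affine hull D)")
  case True
  have "rel_interior D \<subseteq> icr D"
  proof
    fix u assume "u \<in> rel_interior D"
    then obtain e where u: "u \<in> D" and e: "e > 0" "cball u e \<inter> affine hull D \<subseteq> D"
      by (auto simp: mem_rel_interior_cball)
    have "\<exists>\<delta>>0. \<forall>l. 0 \<le> l \<and> l \<le> \<delta> \<longrightarrow> u + l *\<^sub>R (p - u) \<in> D" if p: "p \<in> affine hull D" for p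
    proof (intro exI[of _ "e / (norm (p - u) + 1)"] conjI allI impI)
      show "e / (norm (p - u) + 1) > 0" using e by (simp add: add_nonneg_pos)
      fix l assume l: "0 \<le> l \<and> l \<le> e / (norm (p - u) + 1)"
      have "l * (norm (p - u) + 1) \<le> e"
        using l by (simp add: pos_le_divide_eq add_nonneg_pos)
      moreover have "norm (l *\<^sub>R (p - u)) = l * norm (p - u)" using l by simp
      ultimately have "norm (l *\<^sub>R (p - u)) \<le> e" using l by (simp add: distrib_left)
      then have "u + l *\<^sub>R (p - u) \<in> cball u e" by (simp add: dist_norm)
      moreover have "u + l *\<^sub>R (p - u) \<in> affine hull D"
        using mem_affine[OF affine_affine_hull hull_inc[OF u] p, of "1 - l" l] by (simp add: algebra_simps)
      ultimately show "u + l *\<^sub>R (p - u) \<in> D" using e(2) by blast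
    qed
    with u show "u \<in> icr D" by (simp add: icr_alt[OF D])
  qed
  then show ?thesis by (simp add: ri_def ic_def)
qed (simp add: ri_def)

text \<open>\<open>D\<close> itself need not be convex. If aff D is closed it contains the closure
  of \<open>R\<close>, hence \<open>P\<close>, so the affine hulls agree and the core of
  \<open>D\<close> lies in that of \<open>P\<close>. Conversely a point of \<open>ic P\<close> has a
  relative ball made of points of \<open>ic P\<close>; these lie in \<open>R\<close>, so the ball is
  contained in \<open>D\<close> and already spans aff P.\<close>

lemma ic_ri_squeeze:
  assumes RD: "R \<subseteq> D" and DP: "D \<subseteq> P" and PR: "P \<subseteq> closure R" and ne: "D \<noteq> {}"
    and icR: "ic P \<subseteq> R" and icri: "ic P \<subseteq> ri P"
  shows "ic D = ic P" "ri D = ic P"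
proof -
  have P: "P \<noteq> {}" using ne DP by auto
  have 1: "ic D \<subseteq> ic P"
  proof (cases "closed (affine hull D)")
    case True
    have "P \<subseteq> affine hull D"
    proof -
      have "closure R \<subseteq> affine hull D"
        by (rule closure_minimal[OF _ True]) (use RD hull_subset[of D affine] in blast)
      then show ?thesis using PR by blast
    qed
    then have eq: "affine hull P = affine hull D"
      using DP by (intro subset_antisym hull_minimal hull_mono affine_affine_hull)
    have "icr D \<subseteq> icr P" unfolding icr_alt[OF ne] icr_alt[OF P] eq using DP by blast
    then show ?thesis by (simp add: ic_def eq)
  qed (simp add: ic_def)
  have 2: "ic P \<subseteq> ri D"
  proof
    fix u assume u: "u \<in> ic P"
    then have uri: "u \<in> rel_interior P" and cl: "closed (affine hull P)"
      using icri by (auto simp: ri_def split: if_splits)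
    then obtain e where e: "e > 0" "ball u e \<inter> affine hull P \<subseteq> P"
      by (auto simp: mem_rel_interior_ball)
    \<comment> \<open>Membership in \<open>P\<close> would not be enough: each point of the ball is
      itself relatively interior to \<open>P\<close>, hence in \<open>ic P\<close>, and only
      therefore in \<open>R\<close> and \<open>D\<close>.\<close>
    have ballD: "ball u e \<inter> affine hull P \<subseteq> D"
    proof
      fix q assume q: "q \<in> ball u e \<inter> affine hull P"
      then have "q \<in> P" using e by blast
      moreover have "ball q (e - dist u q) \<inter> affine hull P \<subseteq> P"
      proof -
        have "ball q (e - dist u q) \<subseteq> ball u e"
        proof
          fix z assume "z \<in> ball q (e - dist u q)"
          then show "z \<in> ball u e" using dist_triangle[of u z q] by simp
        qed
        then show ?thesis using e(2) by blast
      qed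
      ultimately have "q \<in> rel_interior P"
        using q by (auto simp: mem_rel_interior_ball intro!: exI[of _ "e - dist u q"])
      then have "q \<in> ic P" using cl ri_subset_ic[OF P] by (auto simp: ri_def)
      then show "q \<in> D" using icR RD by blast
    qed
    have uD: "u \<in> D" using u icR RD by blast
    have "affine hull P \<subseteq> affine hull D"
    proof
      fix p assume p: "p \<in> affine hull P"
      define t where "t = e / (2 * (norm (p - u) + 1))"
      have den: "2 * (norm (p - u) + 1) > 0" by (simp add: add_nonneg_pos)
      have t: "t > 0" using e den by (simp add: t_def)
      have "t * norm (p - u) \<le> t * (norm (p - u) + 1)" using t by (intro mult_left_mono) auto
      also have "\<dots> = e / 2"
      proof -
        have "t * (2 * (norm (p - u) + 1)) = e" unfolding t_def using den by simp
        then show ?thesis by (simp add: algebra_simps)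
      qed
      also have "\<dots> < e" using e by simp
      finally have "u + t *\<^sub>R (p - u) \<in> ball u e" using t by (simp add: dist_norm)
      moreover have "u + t *\<^sub>R (p - u) \<in> affine hull P"
        using mem_affine[OF affine_affine_hull hull_inc p, of u "1 - t" t] uD DP
        by (auto simp: algebra_simps)
      ultimately have q: "u + t *\<^sub>R (p - u) \<in> affine hull D" using ballD by (intro hull_inc) auto
      have "(1 - 1 / t) *\<^sub>R u + (1 / t) *\<^sub>R (u + t *\<^sub>R (p - u)) \<in> affine hull D"
        by (rule mem_affine[OF affine_affine_hull hull_inc[OF uD] q]) simp
      then show "p \<in> affine hull D" using t by (simp add: algebra_simps)
    qed
    then have eq: "affine hull D = affine hull P" using hull_mono[OF DP] by (rule subset_antisym[rotated])
    show "u \<in> ri D"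
      using cl uD e(1) ballD by (auto simp: ri_def eq mem_rel_interior_ball)
  qed
  show "ic D = ic P" "ri D = ic P" using 1 2 ri_subset_ic[OF ne] by auto
qed

lemma ic_translation:
  fixes P :: "'v::real_normed_vector set"
  assumes P: "P \<noteq> {}" and w: "w \<in> ic P"
  shows "0 \<in> ic ((\<lambda>p. p - w) ` P)"
proof -
  have h: "affine hull ((\<lambda>p. p - w) ` P) = (\<lambda>p. p - w) ` (affine hull P)"
    using affine_hull_translation[of "- w" P] by simp
  have cl: "closed (affine hull P)" and wi: "w \<in> icr P"
    using w by (auto simp: ic_def split: if_splits)
  have wP: "w \<in> P" using wi by (simp add: icr_alt[OF P])
  have "closed ((\<lambda>p. p - w) ` (affine hull P))"
    using closed_translation[OF cl, of "- w"] by simp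
  moreover have "0 \<in> icr ((\<lambda>p. p - w) ` P)"
  proof -
    have "0 \<in> (\<lambda>p. p - w) ` P" using wP by (intro image_eqI[of _ _ w]) auto
    moreover have "\<exists>\<delta>>0. \<forall>l. 0 \<le> l \<and> l \<le> \<delta> \<longrightarrow> 0 + l *\<^sub>R (p - w - 0) \<in> (\<lambda>p. p - w) ` P"
      if p: "p \<in> affine hull P" for p
    proof -
      obtain \<delta> where "\<delta> > 0" "\<forall>l. 0 \<le> l \<and> l \<le> \<delta> \<longrightarrow> w + l *\<^sub>R (p - w) \<in> P"
        using wi p by (auto simp: icr_alt[OF P])
      then show ?thesis by (intro exI[of _ \<delta>]) (auto intro!: image_eqI[of _ _ "w + _"])
    qed
    ultimately show ?thesis using P by (subst icr_alt) (auto simp: h)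
  qed
  ultimately show ?thesis by (simp add: ic_def h)
qed

section \<open>Partial infimal convolution and the parallel sum\<close>

abbreviation slope_diff :: "(('a::banach \<times> 'a dual) \<times> real) set \<Rightarrow> (('a \<times> 'a dual) \<times> real) set \<Rightarrow> 'a dual set" where
  "slope_diff E1 E2 \<equiv> set_diff (snd ` fst ` E1) (snd ` fst ` E2)"

lemma slope_diff_iff:
  "w \<in> slope_diff E1 E2 \<longleftrightarrow>
     (\<exists>y v r z v' s. ((y, v), r) \<in> E1 \<and> ((z, v'), s) \<in> E2 \<and> w = v - v')"
  unfolding set_diff_def by (force simp: image_iff)

text \<open>\<open>\<Lambda>\<close> keeps only the difference of the two slopes. Robinson-Ursescu
  turns the algebraic condition at 0 into openness with one bound \<open>N\<close> on all
  coordinates of a preimage, including the heights \<open>r\<close> and \<open>s\<close>; these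
  bounds control the perturbed infimum near 0.\<close>

lemma slope_diff_open:
  fixes E1 E2 :: "(('a::banach \<times> 'a dual) \<times> real) set"
  assumes E1: "strong_epi E1" and E2: "strong_epi E2" and ic: "0 \<in> ic (slope_diff E1 E2)"
  shows "\<exists>d>0. \<exists>N. \<forall>w\<in>span (slope_diff E1 E2). norm w \<le> d \<longrightarrow>
     (\<exists>y v r z v' s. ((y, v), r) \<in> E1 \<and> ((z, v'), s) \<in> E2 \<and> w = v - v' \<and>
        norm y \<le> N \<and> norm v \<le> N \<and> \<bar>r\<bar> \<le> N \<and> norm z \<le> N \<and> \<bar>s\<bar> \<le> N)"
proof -
  let ?P = "slope_diff E1 E2"
  define \<Lambda> where "\<Lambda> = (\<lambda>k :: (('a \<times> 'a dual) \<times> real) \<times> (('a \<times> 'a dual) \<times> real).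
    snd (fst (fst k)) - snd (fst (snd k)))"
  have im: "\<Lambda> ` (E1 \<times> E2) = ?P"
    unfolding set_diff_def \<Lambda>_def by (force simp: image_iff)
  have ne: "?P \<noteq> {}" using strong_epi_nonempty[OF E1] strong_epi_nonempty[OF E2] by (auto simp: im[symmetric])
  have cl: "closed (affine hull ?P)" and i: "0 \<in> icr ?P" using ic by (auto simp: ic_def split: if_splits)
  have P0: "0 \<in> ?P" using i by (simp add: icr_alt[OF ne])
  then have span: "affine hull ?P = span ?P" by (intro affine_hull_span_0 hull_inc)
  have "\<exists>d>0. \<exists>N. \<forall>w\<in>span ?P. norm w \<le> d \<longrightarrow> (\<exists>k\<in>E1 \<times> E2. norm k \<le> N \<and> \<Lambda> k = w)"
  proof (rule robinson_ursescu)
    show "bounded_linear \<Lambda>" unfolding \<Lambda>_def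
      by (intro bounded_linear_sub bounded_linear_compose[OF bounded_linear_snd]
          bounded_linear_compose[OF bounded_linear_fst] bounded_linear_fst bounded_linear_snd)
    show "closed (span ?P)" using cl span by simp
    show "convex (E1 \<times> E2)" "closed (E1 \<times> E2)"
      using E1 E2 by (auto intro: convex_Times closed_Times simp: strong_epi_def)
    show "\<Lambda> ` (E1 \<times> E2) \<subseteq> span ?P" unfolding im by (rule span_superset)
    show "\<exists>t>0. t *\<^sub>R w \<in> \<Lambda> ` (E1 \<times> E2)" if "w \<in> span ?P" for w
    proof -
      have "w \<in> affine hull ?P" using that span by simp
      then obtain \<delta> where "\<delta> > 0" "\<forall>l. 0 \<le> l \<and> l \<le> \<delta> \<longrightarrow> 0 + l *\<^sub>R (w - 0) \<in> ?P"
        using i unfolding icr_alt[OF ne] by blast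
      then show ?thesis unfolding im by (intro exI[of _ \<delta>]) auto
    qed
  qed simp
  then obtain d N where d: "d > 0" and N: "\<And>w. w \<in> span ?P \<Longrightarrow> norm w \<le> d \<Longrightarrow>
      \<exists>k\<in>E1 \<times> E2. norm k \<le> N \<and> \<Lambda> k = w" by blast
  have "\<exists>y v r z v' s. ((y, v), r) \<in> E1 \<and> ((z, v'), s) \<in> E2 \<and> w = v - v' \<and>
        norm y \<le> N \<and> norm v \<le> N \<and> \<bar>r\<bar> \<le> N \<and> norm z \<le> N \<and> \<bar>s\<bar> \<le> N"
    if w: "w \<in> span ?P" "norm w \<le> d" for w
  proof -
    obtain k where kE: "k \<in> E1 \<times> E2" "norm k \<le> N" "\<Lambda> k = w" using N[OF w] by blast
    obtain y v r z v' s where keq: "k = (((y, v), r), ((z, v'), s))" by (metis surj_pair)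
    have k: "((y, v), r) \<in> E1" "((z, v'), s) \<in> E2" "norm (((y, v), r), ((z, v'), s)) \<le> N" "w = v - v'"
      using kE unfolding keq by (simp_all add: \<Lambda>_def)
    have "norm ((y, v), r) \<le> N" "norm ((z, v'), s) \<le> N"
      using k(3) norm_fst_le[of "((y, v), r)" "((z, v'), s)"] norm_snd_le[of "((z, v'), s)" "((y, v), r)"]
      by auto
    then have n: "norm (y, v) \<le> N" "\<bar>r\<bar> \<le> N" "norm (z, v') \<le> N" "\<bar>s\<bar> \<le> N"
      using norm_fst_le[of "(y, v)" r] norm_snd_le[of r "(y, v)"]
        norm_fst_le[of "(z, v')" s] norm_snd_le[of s "(z, v')"] unfolding real_norm_def by linarith+
    have "norm y \<le> N" "norm v \<le> N" "norm z \<le> N"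
      using n norm_fst_le[of y v] norm_snd_le[of v y] norm_fst_le[of z v'] by linarith+
    with k n show ?thesis by blast
  qed
  then show ?thesis using d by blast
qed

text \<open>Exactness of the conjugate of the partial infimal convolution: the multiplier \<open>g\<close> splits
  the functional \<open>b\<close> into \<open>b + g\<close> and \<open>- g\<close>.\<close>
lemma conjugate_sum_split:
  fixes E1 E2 :: "(('a::banach \<times> 'a dual) \<times> real) set" and a :: "'a dual" and b :: "'a bidual"
  assumes E1: "strong_epi E1" and E2: "strong_epi E2" and ic: "0 \<in> ic (slope_diff E1 E2)"
    and le: "\<And>y z v r s. ((y, v), r) \<in> E1 \<Longrightarrow> ((z, v), s) \<in> E2 \<Longrightarrow>
      blinfun_apply a (y + z) + blinfun_apply b v - (r + s) \<le> \<beta>"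
  shows "\<exists>g :: 'a bidual. \<forall>y v r z v' s. ((y, v), r) \<in> E1 \<longrightarrow> ((z, v'), s) \<in> E2 \<longrightarrow>
     (blinfun_apply a y + blinfun_apply (b + g) v - r) + (blinfun_apply a z + blinfun_apply (- g) v' - s) \<le> \<beta>"
proof -
  obtain d N where d: "d > 0" and N: "\<forall>w\<in>span (slope_diff E1 E2). norm w \<le> d \<longrightarrow>
     (\<exists>y v r z v' s. ((y, v), r) \<in> E1 \<and> ((z, v'), s) \<in> E2 \<and> w = v - v' \<and>
        norm y \<le> N \<and> norm v \<le> N \<and> \<bar>r\<bar> \<le> N \<and> norm z \<le> N \<and> \<bar>s\<bar> \<le> N)"
    using slope_diff_open[OF E1 E2 ic] by blast
  \<comment> \<open>The two slopes are allowed to differ by the perturbation \<open>w\<close>; at w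
    = 0 the hypothesis \<open>le\<close> says that the values are nonnegative.\<close>
  define Q where "Q = {(w, \<rho>). \<exists>y v r z v' s. ((y, v), r) \<in> E1 \<and> ((z, v'), s) \<in> E2 \<and> w = v - v' \<and>
     \<rho> = r + s - blinfun_apply a (y + z) - blinfun_apply b v + \<beta>}"
  have QI: "(v - v', r + s - a (y + z) - b v + \<beta>) \<in> Q"
    if "((y, v), r) \<in> E1" "((z, v'), s) \<in> E2" for y v r z v' s
    unfolding Q_def using that by blast
  have "\<exists>g :: 'a bidual. \<forall>(w, \<rho>)\<in>Q. g w \<le> \<rho>"
  proof (rule convex_set_affine_minorant_core[OF _ subspace_span _ _ d])
    show "convex Q"
    proof (rule convexI)
      fix p q and c e :: real
      assume p: "p \<in> Q" and q: "q \<in> Q" and ce: "c \<ge> 0" "e \<ge> 0" "c + e = 1"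
      obtain y v r z v' s where p': "((y, v), r) \<in> E1" "((z, v'), s) \<in> E2"
          "p = (v - v', r + s - a (y + z) - b v + \<beta>)"
        using p by (auto simp: Q_def)
      obtain y1 v1 r1 z1 v1' s1 where q': "((y1, v1), r1) \<in> E1" "((z1, v1'), s1) \<in> E2"
          "q = (v1 - v1', r1 + s1 - a (y1 + z1) - b v1 + \<beta>)"
        using q by (auto simp: Q_def)
      have e: "e = 1 - c" using ce by simp
      have "c *\<^sub>R p + e *\<^sub>R q = ((c *\<^sub>R v + e *\<^sub>R v1) - (c *\<^sub>R v' + e *\<^sub>R v1'),
         (c * r + e * r1) + (c * s + e * s1) - a ((c *\<^sub>R y + e *\<^sub>R y1) + (c *\<^sub>R z + e *\<^sub>R z1))
          - b (c *\<^sub>R v + e *\<^sub>R v1) + \<beta>)"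
        unfolding p' q' e by (simp add: blinfun.bilinear_simps algebra_simps)
      also have "\<dots> \<in> Q"
        by (intro QI convex_combo_pair[OF strong_epi_convex[OF E1] p'(1) q'(1) ce]
            convex_combo_pair[OF strong_epi_convex[OF E2] p'(2) q'(2) ce])
      finally show "c *\<^sub>R p + e *\<^sub>R q \<in> Q" .
    qed
    show "fst ` Q \<subseteq> span (slope_diff E1 E2)"
      by (auto simp: Q_def slope_diff_iff intro!: span_base) blast
    show "\<rho> \<ge> 0" if "(0, \<rho>) \<in> Q" for \<rho>
      using that le unfolding Q_def by fastforce
    show "\<exists>\<rho>\<le>N + N + norm a * (N + N) + norm b * N + \<bar>\<beta>\<bar>. (w, \<rho>) \<in> Q"
      if w: "w \<in> span (slope_diff E1 E2)" "norm w \<le> d" for w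
    proof -
      obtain y v r z v' s where k: "((y, v), r) \<in> E1" "((z, v'), s) \<in> E2" "w = v - v'"
        "norm y \<le> N" "norm v \<le> N" "\<bar>r\<bar> \<le> N" "norm z \<le> N" "\<bar>s\<bar> \<le> N"
        using N w by blast
      have "norm (y + z) \<le> N + N" using norm_triangle_ineq[of y z] k by linarith
      then have "norm a * norm (y + z) \<le> norm a * (N + N)" by (intro mult_left_mono) auto
      then have "- a (y + z) \<le> norm a * (N + N)" using norm_blinfun[of a "y + z"] by simp
      moreover have "- b v \<le> norm b * N"
        using norm_blinfun[of b v] mult_left_mono[OF k(5) norm_ge_zero[of b]] by simp
      ultimately have "r + s - a (y + z) - b v + \<beta> \<le> N + N + norm a * (N + N) + norm b * N + \<bar>\<beta>\<bar>"
        using k by linarith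
      then show ?thesis using QI[OF k(1,2)] k(3) by blast
    qed
  qed
  then obtain g :: "'a bidual" where g: "\<And>w \<rho>. (w, \<rho>) \<in> Q \<Longrightarrow> g w \<le> \<rho>" by blast
  have "(a y + (b + g) v - r) + (a z + (- g) v' - s) \<le> \<beta>"
    if "((y, v), r) \<in> E1" "((z, v'), s) \<in> E2" for y v r z v' s
    using g[OF QI[OF that]] by (simp add: blinfun.bilinear_simps)
  then show ?thesis by blast
qed

text \<open>For epigraphs of h1 and h2 this is, up to closure, the epigraph of the infimum of h1 (y,
  v) + h2 (z, v) over y + z = x. The closure is taken because the sum need not be closed.\<close>

definition psum_epi :: "(('a::banach \<times> 'a dual) \<times> real) set \<Rightarrow> (('a \<times> 'a dual) \<times> real) set
    \<Rightarrow> (('a \<times> 'a dual) \<times> real) set" where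
  "psum_epi E1 E2 = closure {((y + z, v), r + s) | y z v r s. ((y, v), r) \<in> E1 \<and> ((z, v), s) \<in> E2}"

lemma psum_epiI:
  "((y, v), r) \<in> E1 \<Longrightarrow> ((z, v), s) \<in> E2 \<Longrightarrow> ((y + z, v), r + s) \<in> psum_epi E1 E2"
  unfolding psum_epi_def by (rule subsetD[OF closure_subset]) blast

text \<open>Additivity of \<open>coupling\<close> in the first variable carries the lower bound over
  to sums, and continuity to the closure. If the conjugate at \<open>(a, b)\<close> were too small,
  it would split along a multiplier \<open>g\<close>; strongness at \<open>(a, b + g)\<close> and
  \<open>(a, - g)\<close> recovers \<open>(b + g) a + (- g) a = b a\<close> with a loss of only 2 e
  / 3, a contradiction.\<close>

lemma strong_epi_psum:
  fixes E1 E2 :: "(('a::banach \<times> 'a dual) \<times> real) set"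
  assumes E1: "strong_epi E1" and E2: "strong_epi E2" and ic: "0 \<in> ic (slope_diff E1 E2)"
  shows "strong_epi (psum_epi E1 E2)"
proof -
  define E0 where "E0 = {((y + z, v), r + s) | y z v r s. ((y, v), r) \<in> E1 \<and> ((z, v), s) \<in> E2}"
  have cvx: "convex E0"
  proof (rule convexI)
    fix p q and c e :: real
    assume p: "p \<in> E0" and q: "q \<in> E0" and ce: "c \<ge> 0" "e \<ge> 0" "c + e = 1"
    obtain y z v r s where p': "p = ((y + z, v), r + s)" "((y, v), r) \<in> E1" "((z, v), s) \<in> E2"
      using p by (auto simp: E0_def)
    obtain y1 z1 v1 r1 s1 where q': "q = ((y1 + z1, v1), r1 + s1)" "((y1, v1), r1) \<in> E1" "((z1, v1), s1) \<in> E2"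
      using q by (auto simp: E0_def)
    have "c *\<^sub>R p + e *\<^sub>R q = (((c *\<^sub>R y + e *\<^sub>R y1) + (c *\<^sub>R z + e *\<^sub>R z1), c *\<^sub>R v + e *\<^sub>R v1),
        (c * r + e * r1) + (c * s + e * s1))"
      unfolding p' q' by (simp add: algebra_simps)
    moreover have "((c *\<^sub>R y + e *\<^sub>R y1, c *\<^sub>R v + e *\<^sub>R v1), c * r + e * r1) \<in> E1"
      by (rule convex_combo_pair[OF strong_epi_convex[OF E1] p'(2) q'(2) ce])
    moreover have "((c *\<^sub>R z + e *\<^sub>R z1, c *\<^sub>R v + e *\<^sub>R v1), c * s + e * s1) \<in> E2"
      by (rule convex_combo_pair[OF strong_epi_convex[OF E2] p'(3) q'(3) ce])
    ultimately show "c *\<^sub>R p + e *\<^sub>R q \<in> E0" unfolding E0_def by blast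
  qed
  have "closure E0 \<subseteq> {pr. coupling (fst pr) \<le> snd pr}"
  proof (rule closure_minimal)
    show "E0 \<subseteq> {pr. coupling (fst pr) \<le> snd pr}"
      using strong_epi_ge[OF E1] strong_epi_ge[OF E2]
      by (fastforce simp: E0_def coupling_def blinfun.add_right intro: add_mono)
    show "closed {pr :: ('a \<times> 'a dual) \<times> real. coupling (fst pr) \<le> snd pr}"
      unfolding coupling_def by (intro closed_Collect_le continuous_intros)
  qed
  moreover have "\<exists>x x' r. ((x, x'), r) \<in> closure E0 \<and> blinfun_apply a x + blinfun_apply b x' - r \<ge> blinfun_apply b a - e"
    if e: "e > 0" for a :: "'a dual" and b :: "'a bidual" and e
  proof (rule ccontr)
    assume no: "\<not> ?thesis"
    have "a (y + z) + b v - (r + s) \<le> b a - e"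
      if "((y, v), r) \<in> E1" "((z, v), s) \<in> E2" for y z v r s
      using no psum_epiI[OF that] unfolding psum_epi_def E0_def by force
    from conjugate_sum_split[OF E1 E2 ic this]
    obtain g :: "'a bidual" where g: "\<And>y v r z v' s. ((y, v), r) \<in> E1 \<Longrightarrow> ((z, v'), s) \<in> E2 \<Longrightarrow>
       (blinfun_apply a y + blinfun_apply (b + g) v - r) + (blinfun_apply a z + blinfun_apply (- g) v' - s) \<le> b a - e"
      by blast
    have e3: "e / 3 > 0" using e by simp
    obtain y v r where 1: "((y, v), r) \<in> E1" "a y + (b + g) v - r \<ge> (b + g) a - e / 3"
      using strong_epi_conj[OF E1 e3] by blast
    obtain z v' s where 2: "((z, v'), s) \<in> E2" "a z + (- g) v' - s \<ge> (- g) a - e / 3"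
      using strong_epi_conj[OF E2 e3] by blast
    show False using g[OF 1(1) 2(1)] 1(2) 2(2) e by (simp add: blinfun.bilinear_simps)
  qed
  ultimately show ?thesis
    unfolding strong_epi_def psum_epi_def E0_def[symmetric]
    using convex_closure[OF cvx] by auto
qed

text \<open>A contact point minimises the height above \<open>coupling\<close>. This is the
  first-order condition along the segment to \<open>(y, w)\<close>: a violation \<open>A\<close>
  enters linearly in the step, whereas \<open>B\<close> enters quadratically.\<close>

lemma contact_conj_le:
  fixes E :: "(('a::banach \<times> 'a dual) \<times> real) set"
  assumes E: "strong_epi E" and p: "(x, v) \<in> contact E" and q: "((y, w), r) \<in> E"
  shows "blinfun_apply v y + blinfun_apply w x - r \<le> blinfun_apply v x"
proof (rule ccontr)
  assume n: "\<not> ?thesis"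
  define A where "A = v y + w x - r - v x"
  define B where "B = (w - v) (y - x)"
  have A: "A > 0" using n by (simp add: A_def)
  \<comment> \<open>Small enough that \<open>t * \<bar>B\<bar> < A\<close>, so the quadratic term
    cannot make up for the linear one.\<close>
  define t where "t = min (1/2) (A / (2 * (\<bar>B\<bar> + 1)))"
  have t: "0 < t" "t < 1" using A by (auto simp: t_def)
  have "t * (2 * (\<bar>B\<bar> + 1)) \<le> A"
  proof -
    have "t \<le> A / (2 * (\<bar>B\<bar> + 1))" by (simp add: t_def)
    then show ?thesis by (simp only: pos_le_divide_eq add_nonneg_pos abs_ge_zero mult_pos_pos zero_less_numeral zero_less_one)
  qed
  then have tB: "t * (2 * \<bar>B\<bar>) + 2 * t \<le> A" by (simp add: algebra_simps)
  have "((x, v), v x) \<in> E" using p by (simp add: contact_def coupling_def)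
  then have "((t *\<^sub>R y + (1 - t) *\<^sub>R x, t *\<^sub>R w + (1 - t) *\<^sub>R v), t * r + (1 - t) * v x) \<in> E"
    using t by (intro convex_combo_pair[OF strong_epi_convex[OF E] q]) auto
  from strong_epi_ge[OF E this]
  have "t * (t * B) \<le> t * (- A)"
    by (simp add: A_def B_def blinfun.bilinear_simps algebra_simps)
  then have "t * B \<le> - A" using t(1) by (simp only: mult_le_cancel_left_pos)
  moreover have "- (t * \<bar>B\<bar>) \<le> t * B" using t by (simp add: abs_if)
  ultimately show False using tB A t by linarith
qed

lemma canon_diff: "canon (x - y) = canon x - canon y"
  by (rule blinfun_eqI) (simp add: blinfun.bilinear_simps)

text \<open>At a contact point \<open>(x, v)\<close> of the sum the conjugate at
  \<open>(v, canon x)\<close> is at most \<open>v x\<close>. The multiplier splits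
  \<open>canon x\<close> into \<open>canon x + g\<close> and \<open>- g\<close>, whose values at
  \<open>v\<close> add up to \<open>v x\<close>. Strongness bounds each partial conjugate from below
  by its own share, so each is also bounded above by it, and this places both pieces over
  \<open>v\<close> in the Gossez closures.\<close>

theorem contact_psum:
  fixes E1 E2 :: "(('a::banach \<times> 'a dual) \<times> real) set"
  assumes E1: "strong_epi E1" and E2: "strong_epi E2" and ic: "0 \<in> ic (slope_diff E1 E2)"
    and dom: "gossez_dom_in_X (contact E1) \<or> gossez_dom_in_X (contact E2)"
  shows "contact (psum_epi E1 E2) = parallel_sum (contact E1) (contact E2)"
proof
  show "parallel_sum (contact E1) (contact E2) \<subseteq> contact (psum_epi E1 E2)"
    using psum_epiI[of _ _ _ E1 _ _ E2]
    by (fastforce simp: parallel_sum_def contact_def coupling_def blinfun.add_right)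
  show "contact (psum_epi E1 E2) \<subseteq> parallel_sum (contact E1) (contact E2)"
  proof clarify
    fix x v assume xv: "(x, v) \<in> contact (psum_epi E1 E2)"
    have "v (y + z) + canon x w - (r + s) \<le> v x"
      if "((y, w), r) \<in> E1" "((z, w), s) \<in> E2" for y z w r s
      using contact_conj_le[OF strong_epi_psum[OF E1 E2 ic] xv psum_epiI[OF that]] by simp
    from conjugate_sum_split[OF E1 E2 ic this]
    obtain g :: "'a bidual" where g: "\<And>y w r z w' s. ((y, w), r) \<in> E1 \<Longrightarrow> ((z, w'), s) \<in> E2 \<Longrightarrow>
       (blinfun_apply v y + blinfun_apply (canon x + g) w - r) + (blinfun_apply v z + blinfun_apply (- g) w' - s) \<le> v x"
      by blast
    have g1: "v y + (canon x + g) w - r \<le> (canon x + g) v" if m: "((y, w), r) \<in> E1" for y w r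
    proof (rule field_le_epsilon)
      fix e :: real assume e: "e > 0"
      obtain z w' s where "((z, w'), s) \<in> E2" "v z + (- g) w' - s \<ge> (- g) v - e"
        using strong_epi_conj[OF E2 e] by blast
      then show "v y + (canon x + g) w - r \<le> (canon x + g) v + e"
        using g[OF m, of z w' s] by (simp add: blinfun.bilinear_simps)
    qed
    have g2: "v z + (- g) w - s \<le> (- g) v" if m: "((z, w), s) \<in> E2" for z w s
    proof (rule field_le_epsilon)
      fix e :: real assume e: "e > 0"
      obtain y w' r where "((y, w'), r) \<in> E1" "v y + (canon x + g) w' - r \<ge> (canon x + g) v - e"
        using strong_epi_conj[OF E1 e] by blast
      then show "v z + (- g) w - s \<le> (- g) v + e"
        using g[OF _ m, of y w' r] by (simp add: blinfun.bilinear_simps)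
    qed
    \<comment> \<open>With \<open>r\<close> equal to the coupling of \<open>(y, w)\<close>, the
      inequality \<open>g1\<close> is exactly the defining inequality of the closure.\<close>
    have c1: "(canon x + g, v) \<in> gossez_closure (contact E1)"
      using g1 by (fastforce simp: gossez_closure_def contact_def coupling_def blinfun.bilinear_simps)
    have c2: "(- g, v) \<in> gossez_closure (contact E2)"
      using g2 by (fastforce simp: gossez_closure_def contact_def coupling_def blinfun.bilinear_simps)
    \<comment> \<open>The pieces add up to \<open>canon x\<close>, so as soon as one of them comes
      from X the other does too.\<close>
    have "\<exists>y z. canon x + g = canon y \<and> - g = canon z \<and> x = y + z"
      using dom
    proof
      assume "gossez_dom_in_X (contact E1)"
      then obtain y where y: "canon x + g = canon y" using c1 by (force simp: gossez_dom_in_X_def)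
      then show ?thesis by (intro exI[of _ y] exI[of _ "x - y"]) (simp add: canon_diff flip: y)
    next
      assume "gossez_dom_in_X (contact E2)"
      then obtain z where z: "- g = canon z" using c2 by (force simp: gossez_dom_in_X_def)
      then show ?thesis by (intro exI[of _ "x - z"] exI[of _ z]) (simp add: canon_diff flip: z)
    qed
    then obtain y z where "canon x + g = canon y" "- g = canon z" "x = y + z" by blast
    then show "(x, v) \<in> parallel_sum (contact E1) (contact E2)"
      using contact_closure_canon[OF E1, of y v] contact_closure_canon[OF E2, of z v] c1 c2
      by (auto simp: parallel_sum_def)
  qed
qed

section \<open>Representative functions\<close>

definition epi :: "('b \<Rightarrow> ereal) \<Rightarrow> ('b \<times> real) set" where
  "epi h = {(p, r). h p \<le> ereal r}"

lemma convex_epi: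
  assumes "convex_ereal h"
  shows "convex (epi h)"
proof (rule convexI)
  fix a b and u v :: real
  assume a: "a \<in> epi h" and b: "b \<in> epi h" and uv: "u \<ge> 0" "v \<ge> 0" "u + v = 1"
  obtain p r q s where p: "a = (p, r)" "h p \<le> ereal r" and q: "b = (q, s)" "h q \<le> ereal s"
    using a b by (auto simp: epi_def)
  \<comment> \<open>\<open>convex_ereal\<close> speaks only of weights strictly between 0 and 1, so
    the end points are treated apart and no product of 0 with infinity arises.\<close>
  consider "u = 0" | "u = 1" | "0 < u" "u < 1" using uv by linarith
  then show "u *\<^sub>R a + v *\<^sub>R b \<in> epi h"
  proof cases
    case 3
    have v: "v = 1 - u" using uv by simp
    have "h (u *\<^sub>R p + (1 - u) *\<^sub>R q) \<le> ereal u * h p + ereal (1 - u) * h q"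
      using assms 3 by (simp add: convex_ereal_def)
    also have "\<dots> \<le> ereal u * ereal r + ereal (1 - u) * ereal s"
      using p(2) q(2) 3 by (intro add_mono ereal_mult_left_mono) auto
    finally show ?thesis by (simp add: epi_def p(1) q(1) v)
  qed (use a b uv in auto)
qed

text \<open>\<open>lsc_ereal\<close> gives closed sublevel sets at fixed heights, whereas the
  heights along a sequence vary. Raising the limit height by \<open>e\<close> provides one level for
  all late terms.\<close>

lemma closed_epi:
  assumes "lsc_ereal (h :: 'b::metric_space \<Rightarrow> ereal)"
  shows "closed (epi h)"
proof (unfold closed_sequential_limits, intro allI impI, elim conjE)
  fix f l assume f: "\<forall>n. f n \<in> epi h" and lim: "f \<longlonglongrightarrow> l"
  have "h (fst l) \<le> ereal (snd l + e)" if e: "e > 0" for e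
  proof -
    have "(\<lambda>n. snd (f n)) \<longlonglongrightarrow> snd l" by (rule tendsto_snd[OF lim])
    then have "\<forall>\<^sub>F n in sequentially. snd (f n) < snd l + e" by (rule order_tendstoD) (use e in simp)
    then have "\<forall>\<^sub>F n in sequentially. fst (f n) \<in> {p. h p \<le> ereal (snd l + e)}"
    proof (rule eventually_mono)
      fix n assume "snd (f n) < snd l + e"
      moreover have "h (fst (f n)) \<le> ereal (snd (f n))" using spec[OF f, of n] by (simp add: epi_def case_prod_unfold)
      ultimately have "h (fst (f n)) \<le> ereal (snd l + e)"
        by (metis ereal_less_eq(3) less_imp_le order_trans)
      then show "fst (f n) \<in> {p. h p \<le> ereal (snd l + e)}" by simp
    qed
    moreover have "closed {p. h p \<le> ereal (snd l + e)}" using assms unfolding lsc_ereal_def by blast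
    ultimately have "fst l \<in> {p. h p \<le> ereal (snd l + e)}"
      by (intro Lim_in_closed_set[OF _ _ sequentially_bot tendsto_fst[OF lim]])
    then show ?thesis by simp
  qed
  note le = this
  have "h (fst l) \<le> ereal (snd l)"
    by (rule ereal_le_epsilon2) (simp add: le)
  then show "l \<in> epi h" by (simp add: epi_def case_prod_unfold)
qed

lemma strong_representative_ge: "strong_representative G h \<Longrightarrow> ereal (coupling p) \<le> h p"
  unfolding strong_representative_def representative_def by blast

lemma strong_epi_epi:
  assumes h: "strong_representative G h"
  shows "strong_epi (epi h)"
  unfolding strong_epi_def
proof (intro conjI allI impI)
  have rep: "convex_ereal h" "lsc_ereal h"
    using h by (auto simp: strong_representative_def representative_def)
  note ge = strong_representative_ge[OF h]
  show "convex (epi h)" "closed (epi h)" by (rule convex_epi[OF rep(1)], rule closed_epi[OF rep(2)])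
  show "\<forall>(p, r)\<in>epi h. coupling p \<le> r"
  proof (safe, unfold epi_def, safe)
    fix x v r assume "h (x, v) \<le> ereal r"
    with ge[of "(x, v)"] have "ereal (coupling (x, v)) \<le> ereal r" by (rule order_trans)
    then show "coupling (x, v) \<le> r" by simp
  qed
  fix a :: "'a dual" and b :: "'a bidual" and e :: real
  assume e: "e > 0"
  have "ereal (b a - e) < ereal (b a)" using e by simp
  also have "\<dots> \<le> conj_rep h a b" using h by (simp add: strong_representative_def)
  finally obtain p where p: "ereal (b a - e) < ereal (a (fst p) + b (snd p)) - h p"
    unfolding conj_rep_def less_SUP_iff by blast
  have "h p \<noteq> \<infinity>" using p by auto
  moreover have "h p \<noteq> - \<infinity>" using ge[of p] by auto
  ultimately obtain r where r: "h p = ereal r" by (cases "h p") auto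
  have "((fst p, snd p), r) \<in> epi h" by (simp add: epi_def r)
  moreover have "b a - e \<le> a (fst p) + b (snd p) - r" using p by (simp add: r)
  ultimately show "\<exists>x x' r. ((x, x'), r) \<in> epi h \<and> b a - e \<le> blinfun_apply a x + blinfun_apply b x' - r"
    by blast
qed

text \<open>The contact set is a monotone extension of \<open>G\<close>, and maximality makes it
  equal to \<open>G\<close>.\<close>

lemma contact_epi:
  assumes h: "strong_representative G h" and G: "maximal_monotone G"
  shows "contact (epi h) = G"
proof -
  have "G \<subseteq> contact (epi h)"
    using h by (auto simp: strong_representative_def representative_def contact_def epi_def)
  with contact_monotone[OF strong_epi_epi[OF h]] G show ?thesis by (simp add: maximal_monotone_def)
qed

lemma fst_epi:
  assumes "strong_representative G h"
  shows "fst ` epi h = dom_ereal h"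
proof -
  note ge = strong_representative_ge[OF assms]
  have "p \<in> fst ` epi h" if fin: "h p < \<infinity>" for p
  proof -
    have "h p \<noteq> - \<infinity>" using ge[of p] by auto
    then obtain r where "h p = ereal r" using fin by (cases "h p") auto
    then show ?thesis by (intro image_eqI[of _ _ "(p, r)"]) (auto simp: epi_def)
  qed
  then show ?thesis by (auto simp: epi_def dom_ereal_def)
qed

text \<open>For the epigraph of h this is the epigraph of h (x, v - w) + w x, which belongs to the
  operator with all values translated by \<open>w\<close>. The term w x keeps the height above
  \<open>coupling\<close> unchanged.\<close>

definition shift_epi :: "'a::banach dual \<Rightarrow> (('a \<times> 'a dual) \<times> real) set \<Rightarrow> (('a \<times> 'a dual) \<times> real) set" where
  "shift_epi w E = {((x, v), r). ((x, v - w), r - blinfun_apply w x) \<in> E}"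

text \<open>Strongness at \<open>(a, b)\<close> is that of \<open>E\<close> at
  \<open>(a - w, b)\<close>: shifting the slope adds \<open>b w\<close>, which restores
  \<open>b a\<close>.\<close>

lemma strong_epi_shift:
  fixes E :: "(('a::banach \<times> 'a dual) \<times> real) set"
  assumes E: "strong_epi E"
  shows "strong_epi (shift_epi w E)"
  unfolding strong_epi_def
proof (intro conjI allI impI)
  define f where "f = (\<lambda>pr :: ('a \<times> 'a dual) \<times> real.
    ((fst (fst pr), snd (fst pr) - w), snd pr - blinfun_apply w (fst (fst pr))))"
  have eq: "shift_epi w E = f -` E" by (auto simp: shift_epi_def f_def)
  have "continuous_on UNIV f" unfolding f_def by (intro continuous_intros)
  then show "closed (shift_epi w E)" unfolding eq by (rule closed_vimage[OF strong_epi_closed[OF E]])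
  show "convex (shift_epi w E)"
  proof (rule convexI)
    fix p q and u v :: real
    assume "p \<in> shift_epi w E" "q \<in> shift_epi w E" and uv: "u \<ge> 0" "v \<ge> 0" "u + v = 1"
    then have "u *\<^sub>R f p + v *\<^sub>R f q \<in> E"
      unfolding eq by (intro convexD[OF strong_epi_convex[OF E]]) auto
    moreover have "f (u *\<^sub>R p + v *\<^sub>R q) = u *\<^sub>R f p + v *\<^sub>R f q"
    proof -
      have v: "v = 1 - u" using uv by simp
      show ?thesis unfolding v by (simp add: f_def blinfun.bilinear_simps algebra_simps)
    qed
    ultimately show "u *\<^sub>R p + v *\<^sub>R q \<in> shift_epi w E" unfolding eq by simp
  qed
  show "\<forall>(p, r)\<in>shift_epi w E. coupling p \<le> r"
  proof clarify
    fix x v r assume "((x, v), r) \<in> shift_epi w E"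
    then have "(v - w) x \<le> r - w x" unfolding shift_epi_def by (auto dest: strong_epi_ge[OF E])
    then show "coupling (x, v) \<le> r" by (simp add: coupling_def blinfun.diff_left)
  qed
  fix a :: "'a dual" and b :: "'a bidual" and e :: real
  assume e: "e > 0"
  obtain x v r where E1: "((x, v), r) \<in> E" and c: "(a - w) x + b v - r \<ge> b (a - w) - e"
    using strong_epi_conj[OF E e] by blast
  have "((x, v + w), r + w x) \<in> shift_epi w E" using E1 by (simp add: shift_epi_def)
  moreover have "b a - e \<le> a x + b (v + w) - (r + w x)"
    using c by (simp add: blinfun.bilinear_simps)
  ultimately show "\<exists>x x' r. ((x, x'), r) \<in> shift_epi w E \<and> b a - e \<le> blinfun_apply a x + blinfun_apply b x' - r"
    by blast
qed

lemma contact_shift: "(x, v) \<in> contact (shift_epi w E) \<longleftrightarrow> (x, v - w) \<in> contact E"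
  by (simp add: contact_def shift_epi_def coupling_def blinfun.diff_left)

lemma gossez_dom_in_X_shift:
  assumes "gossez_dom_in_X (contact E)"
  shows "gossez_dom_in_X (contact (shift_epi w E))"
  unfolding gossez_dom_in_X_def
proof clarify
  fix u v assume uv: "(u, v) \<in> gossez_closure (contact (shift_epi w E))"
  have "blinfun_apply (u - canon y) (v - w - y') \<ge> 0" if "(y, y') \<in> contact E" for y y'
  proof -
    have "(y, y' + w) \<in> contact (shift_epi w E)" using that by (simp add: contact_shift)
    then have "blinfun_apply (u - canon y) (v - (y' + w)) \<ge> 0" using uv by (auto simp: gossez_closure_def)
    then show ?thesis by (simp add: algebra_simps)
  qed
  then have "(u, v - w) \<in> gossez_closure (contact E)" by (auto simp: gossez_closure_def)
  then show "fst (u, v) \<in> range canon" using assms by (force simp: gossez_dom_in_X_def)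
qed

lemma slope_diff_shift:
  "slope_diff E1 (shift_epi w E2) = (\<lambda>p. p - w) ` slope_diff E1 E2"
proof (intro set_eqI iffI)
  fix u assume "u \<in> slope_diff E1 (shift_epi w E2)"
  then obtain y v r z v' s where "((y, v), r) \<in> E1" "((z, v' - w), s - w z) \<in> E2" "u = v - v'"
    by (auto simp: slope_diff_iff shift_epi_def)
  then have "v - (v' - w) \<in> slope_diff E1 E2" "u = v - (v' - w) - w"
    unfolding slope_diff_iff by (blast, simp)
  then show "u \<in> (\<lambda>p. p - w) ` slope_diff E1 E2" by blast
next
  fix u assume "u \<in> (\<lambda>p. p - w) ` slope_diff E1 E2"
  then obtain y v r z v' s where k: "((y, v), r) \<in> E1" "((z, v'), s) \<in> E2" "u = v - v' - w"
    by (auto simp: slope_diff_iff)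
  have "((z, v' + w), s + w z) \<in> shift_epi w E2" using k by (simp add: shift_epi_def)
  moreover have "u = v - (v' + w)" using k by simp
  ultimately show "u \<in> slope_diff E1 (shift_epi w E2)" unfolding slope_diff_iff using k(1) by blast
qed

lemma slope_diff_nonempty:
  assumes "strong_epi E1" "strong_epi E2" shows "slope_diff E1 E2 \<noteq> {}"
proof -
  obtain y v r where "((y, v), r) \<in> E1" using strong_epi_nonempty[OF assms(1)] by auto
  moreover obtain z v' s where "((z, v'), s) \<in> E2" using strong_epi_nonempty[OF assms(2)] by auto
  ultimately have "v - v' \<in> slope_diff E1 E2" unfolding slope_diff_iff by blast
  then show ?thesis by blast
qed

lemma maximal_monotone_nonempty:
  assumes "maximal_monotone G" shows "G \<noteq> {}"
proof
  assume "G = {}"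
  moreover have "monotone_op {(0, 0)}" by (simp add: monotone_op_def)
  ultimately show False using assms by (auto simp: maximal_monotone_def)
qed

lemma gossez_D_parallel_sum:
  fixes E1 E2 :: "(('a::banach \<times> 'a dual) \<times> real) set"
  assumes E1: "strong_epi E1" and E2: "strong_epi E2" and ic: "0 \<in> ic (slope_diff E1 E2)"
    and dom: "gossez_dom_in_X (contact E1) \<or> gossez_dom_in_X (contact E2)"
  shows "gossez_D (parallel_sum (contact E1) (contact E2))"
  using strong_epi_gossez_D[OF strong_epi_psum[OF E1 E2 ic]] contact_psum[OF assms] by simp

text \<open>Translating \<open>w\<close> to the origin, \<open>w\<close> is a difference of ranges because the corresponding
  parallel sum, being maximal monotone, has nonempty graph.\<close>
lemma ic_slope_diff_subset_range_diff:
  fixes E1 E2 :: "(('a::banach \<times> 'a dual) \<times> real) set"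
  assumes E1: "strong_epi E1" and E2: "strong_epi E2"
    and dom: "gossez_dom_in_X (contact E1) \<or> gossez_dom_in_X (contact E2)"
  shows "ic (slope_diff E1 E2) \<subseteq> set_diff (range_op (contact E1)) (range_op (contact E2))"
proof
  fix w assume w: "w \<in> ic (slope_diff E1 E2)"
  have "slope_diff E1 E2 \<noteq> {}"
    by (rule slope_diff_nonempty[OF E1 E2])
  then have "0 \<in> ic (slope_diff E1 (shift_epi w E2))"
    using w by (simp add: slope_diff_shift ic_translation)
  then have "gossez_D (parallel_sum (contact E1) (contact (shift_epi w E2)))"
    using dom gossez_dom_in_X_shift by (intro gossez_D_parallel_sum E1 strong_epi_shift E2) auto
  then have "parallel_sum (contact E1) (contact (shift_epi w E2)) \<noteq> {}"
    by (intro maximal_monotone_nonempty) (simp add: gossez_D_def)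
  then obtain y z v where v: "(y, v) \<in> contact E1" "(z, v - w) \<in> contact E2"
    by (auto simp: parallel_sum_def contact_shift)
  then have "v \<in> range_op (contact E1)" "v - w \<in> range_op (contact E2)"
    by (force simp: range_op_def)+
  moreover have "w = v - (v - w)" by simp
  ultimately show "w \<in> set_diff (range_op (contact E1)) (range_op (contact E2))"
    unfolding set_diff_def by blast
qed

text \<open>With \<open>w\<close> moved to 0, the openness lemma gives a ball of the span inside the
  translated set, and the span contains the translated affine hull.\<close>

lemma ic_slope_diff_subset_ri:
  fixes E1 E2 :: "(('a::banach \<times> 'a dual) \<times> real) set"
  assumes E1: "strong_epi E1" and E2: "strong_epi E2"
  shows "ic (slope_diff E1 E2) \<subseteq> ri (slope_diff E1 E2)"
proof
  let ?P = "slope_diff E1 E2"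
  fix w assume w: "w \<in> ic ?P"
  have ne: "?P \<noteq> {}"
    by (rule slope_diff_nonempty[OF E1 E2])
  have cl: "closed (affine hull ?P)" and wP: "w \<in> ?P"
    using w by (auto simp: ic_def icr_alt[OF ne] split: if_splits)
  have ic: "0 \<in> ic (slope_diff E1 (shift_epi w E2))"
    using w ne by (simp add: slope_diff_shift ic_translation)
  obtain d where d: "d > 0" and sub: "\<And>u. u \<in> span (slope_diff E1 (shift_epi w E2)) \<Longrightarrow> norm u \<le> d \<Longrightarrow>
     u \<in> slope_diff E1 (shift_epi w E2)"
    using slope_diff_open[OF E1 strong_epi_shift[OF E2] ic] unfolding slope_diff_iff by blast
  have "p \<in> ?P" if p: "p \<in> cball w d" "p \<in> affine hull ?P" for p
  proof -
    have "p - w \<in> (\<lambda>p. p - w) ` (affine hull ?P)" using p by blast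
    also have "\<dots> = affine hull ((\<lambda>p. p - w) ` ?P)"
      using affine_hull_translation[of "- w" ?P] by simp
    also have "\<dots> \<subseteq> span (slope_diff E1 (shift_epi w E2))"
      unfolding slope_diff_shift by (rule affine_hull_subset_span)
    finally have "p - w \<in> slope_diff E1 (shift_epi w E2)"
      using p(1) by (intro sub) (auto simp: dist_norm norm_minus_commute)
    then show ?thesis by (auto simp: slope_diff_shift)
  qed
  then show "w \<in> ri ?P"
    using cl d wP by (auto simp: ri_def mem_rel_interior_cball)
qed

lemma slope_diff_subset_closure:
  fixes E1 E2 :: "(('a::banach \<times> 'a dual) \<times> real) set"
  assumes E1: "strong_epi E1" and E2: "strong_epi E2"
  shows "slope_diff E1 E2 \<subseteq> closure (set_diff (range_op (contact E1)) (range_op (contact E2)))"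
proof
  fix w assume "w \<in> slope_diff E1 E2"
  then obtain y v r z v' s where k: "((y, v), r) \<in> E1" "((z, v'), s) \<in> E2" "w = v - v'"
    by (auto simp: slope_diff_iff)
  obtain f where f: "\<And>n. f n \<in> range_op (contact E1)" "f \<longlonglongrightarrow> v"
    using strong_epi_range_dense[OF E1 k(1)] unfolding closure_sequential range_op_def by blast
  obtain g where g: "\<And>n. g n \<in> range_op (contact E2)" "g \<longlonglongrightarrow> v'"
    using strong_epi_range_dense[OF E2 k(2)] unfolding closure_sequential range_op_def by blast
  have "f n - g n \<in> set_diff (range_op (contact E1)) (range_op (contact E2))" for n
    using f(1) g(1) unfolding set_diff_def by blast
  with tendsto_diff[OF f(2) g(2)]
  show "w \<in> closure (set_diff (range_op (contact E1)) (range_op (contact E2)))"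
    unfolding closure_sequential k(3) by (intro exI[of _ "\<lambda>n. f n - g n"]) auto
qed

lemma set_diff_mono: "A \<subseteq> A' \<Longrightarrow> B \<subseteq> B' \<Longrightarrow> set_diff A B \<subseteq> set_diff A' B'"
  unfolding set_diff_def by blast

theorem theorem4p3:
  fixes S T :: "'a::banach mop"
    and hS hT :: "'a \<times> ('a \<Rightarrow>\<^sub>L real) \<Rightarrow> ereal"
  assumes nonzero: "\<exists>x::'a. x \<noteq> 0"
    and DS: "gossez_D S" and DT: "gossez_D T"
    and hS: "strong_representative S hS" and hT: "strong_representative T hT"
    and inter: "snd ` dom_ereal hS \<inter> snd ` dom_ereal hT \<noteq> {}"
    and dom: "gossez_dom_in_X S \<or> gossez_dom_in_X T"
  shows
    "(let P = set_diff (snd ` dom_ereal hS) (snd ` dom_ereal hT);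
          R = set_diff (range_op S) (range_op T);
          C = set_diff (convex hull range_op S) (convex hull range_op T)
      in ic R = ri R \<and> ri R = ic C \<and> ic C = ri C \<and> ri C = ic P \<and> ic P = ri P \<and>
         ((0 \<in> ic R \<longleftrightarrow> 0 \<in> ri R) \<and> (0 \<in> ri R \<longleftrightarrow> 0 \<in> ic C) \<and>
          (0 \<in> ic C \<longleftrightarrow> 0 \<in> ri C) \<and> (0 \<in> ri C \<longleftrightarrow> 0 \<in> ic P) \<and>
          (0 \<in> ic P \<longleftrightarrow> 0 \<in> ri P)) \<and>
         (0 \<in> ic R \<longrightarrow> gossez_D (parallel_sum S T)))"
proof -
  note E1 = strong_epi_epi[OF hS] and E2 = strong_epi_epi[OF hT]
  have S: "contact (epi hS) = S" and T: "contact (epi hT) = T"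
    using contact_epi[OF hS] contact_epi[OF hT] DS DT by (auto simp: gossez_D_def)
  define P where "P = set_diff (snd ` dom_ereal hS) (snd ` dom_ereal hT)"
  define R where "R = set_diff (range_op S) (range_op T)"
  define C where "C = set_diff (convex hull range_op S) (convex hull range_op T)"
  have P: "P = slope_diff (epi hS) (epi hT)"
    by (simp add: P_def fst_epi[OF hS] fst_epi[OF hT])
  have icR: "ic P \<subseteq> R"
    using ic_slope_diff_subset_range_diff[OF E1 E2] dom by (simp add: P R_def S T)
  have icri: "ic P \<subseteq> ri P" using ic_slope_diff_subset_ri[OF E1 E2] by (simp add: P)
  have PR: "P \<subseteq> closure R" using slope_diff_subset_closure[OF E1 E2] by (simp add: P R_def S T)
  have RC: "R \<subseteq> C" unfolding R_def C_def by (intro set_diff_mono hull_subset)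
  \<comment> \<open>The projection of an epigraph to the dual is convex and contains the range,
    hence also its convex hull.\<close>
  have CP: "C \<subseteq> P"
  proof -
    have "convex hull range_op (contact (epi h)) \<subseteq> snd ` fst ` epi h"
      if h: "strong_representative G h" for G :: "'a mop" and h
    proof (rule hull_minimal)
      show "range_op (contact (epi h)) \<subseteq> snd ` fst ` epi h"
        by (force simp: range_op_def contact_def)
      show "convex (snd ` fst ` epi h)"
        by (intro convex_linear_image strong_epi_convex[OF strong_epi_epi[OF h]] linear_fst linear_snd)
    qed
    from set_diff_mono[OF this[OF hS] this[OF hT]] show ?thesis by (simp add: C_def P S T)
  qed
  have "maximal_monotone S" "maximal_monotone T" using DS DT by (simp_all add: gossez_D_def)
  then have "S \<noteq> {}" "T \<noteq> {}"
    by (simp_all only: maximal_monotone_nonempty not_False_eq_True simp_thms)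
  then obtain x v y w where "(x, v) \<in> S" "(y, w) \<in> T" by fast
  then have "v \<in> range_op S" "w \<in> range_op T" by (force simp: range_op_def)+
  then have R: "R \<noteq> {}" unfolding R_def set_diff_def by blast
  then have C: "C \<noteq> {}" and ne: "P \<noteq> {}" using RC CP by blast+
  \<comment> \<open>The squeeze is used with \<open>R\<close>, \<open>C\<close> and \<open>P\<close>
    in turn in the middle position.\<close>
  have "ic R = ic P" "ri R = ic P"
    by (rule ic_ri_squeeze[OF subset_refl order_trans[OF RC CP] PR R icR icri])+
  moreover have "ic C = ic P" "ri C = ic P"
    by (rule ic_ri_squeeze[OF RC CP PR C icR icri])+
  moreover have "ri P = ic P"
    by (rule ic_ri_squeeze(2)[OF order_trans[OF RC CP] subset_refl PR ne icR icri])
  moreover have "gossez_D (parallel_sum S T)" if "0 \<in> ic P"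
    using gossez_D_parallel_sum[OF E1 E2] that dom by (simp add: P S T)
  ultimately show ?thesis
    unfolding Let_def P_def[symmetric] R_def[symmetric] C_def[symmetric] by simp
qed

end
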